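(* For every $n\ge1$, the number $\#AD_n$ of domino tilings of the Aztec diamond $AD_n$ is $$\#AD_n=\det\begin{bmatrix} S_n & I_n\\ -I_n & S_n^T\end{bmatrix},$$ where $S_n$ is the $n\times n$ upper triangular matrix with the $i$-th large Schröder number on its $i$-th superdiagonal, i.e. $(S_n)_{pq}=s_{q-p}$ for $q\ge p$ and $0$ otherwise.
   Context: The Aztec diamond $AD_n$ is the union of the $2n(n+1)$ unit squares in the plane whose vertices are integral points $(x,y)$ with $|x|+|y|\le n+1$. A domino tiling is a tiling by $1\times2$ and $2\times1$ rectangles made of two unit squares. The $m$-th large Schröder number $s_m$ ($m\ge0$) is the number of lattice paths from $(0,0)$ to $(m,m)$ using steps $(0,1)$, $(1,0)$, $(1,1)$ that do not pass above the line $y=x$; $s_0,\dots,s_5=1,2,6,22,90,394$. The $0$-th superdiagonal is the main diagonal. *)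

theory Defs
  imports "HOL-Analysis.Tagged_Division" "Jordan_Normal_Form.Determinant"
begin

definition unit_square :: "int \<Rightarrow> int \<Rightarrow> (real \<times> real) set" where
  "unit_square a b = cbox (of_int a, of_int b) (of_int (a + 1), of_int (b + 1))"

definition aztec_diamond :: "nat \<Rightarrow> (real \<times> real) set" where
  "aztec_diamond n =
     \<Union> {unit_square a b | a b.
         \<forall>x \<in> {a, a + 1}. \<forall>y \<in> {b, b + 1}. \<bar>x\<bar> + \<bar>y\<bar> \<le> int n + 1}"

text \<open>The corners are integral, so that a domino is the union of two unit squares of the
  integer grid.\<close>

definition domino :: "(real \<times> real) set \<Rightarrow> bool" where
  "domino K \<longleftrightarrow>
     (\<exists>a b :: int. K = cbox (of_int a, of_int b) (of_int (a + 2), of_int (b + 1)) \<or>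
                   K = cbox (of_int a, of_int b) (of_int (a + 1), of_int (b + 2)))"

text \<open>A division of a region is a finite set of closed boxes that covers it exactly, any two
  distinct boxes having disjoint interiors.\<close>

definition domino_tilings :: "(real \<times> real) set \<Rightarrow> (real \<times> real) set set set" where
  "domino_tilings R = {T. T division_of R \<and> (\<forall>K \<in> T. domino K)}"

text \<open>A path starting at the origin is given by its list of steps. The vertex reached after
  \<open>k\<close> steps is the sum of the first \<open>k\<close> steps. As the steps are straight, the path does not
  pass above the diagonal iff none of its vertices lies above it.\<close>

definition schroeder_paths :: "nat \<Rightarrow> (nat \<times> nat) list set" where
  "schroeder_paths m =
     {p. set p \<subseteq> {(0, 1), (1, 0), (1, 1)} \<and> sum_list p = (m, m) \<and>
         (\<forall>k \<le> length p. snd (sum_list (take k p)) \<le> fst (sum_list (take k p)))}"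

definition large_schroeder :: "nat \<Rightarrow> nat" where
  "large_schroeder m = card (schroeder_paths m)"

definition schroeder_mat :: "nat \<Rightarrow> int mat" where
  "schroeder_mat n =
     mat n n (\<lambda>(p, q). if p \<le> q then int (large_schroeder (q - p)) else 0)"

end

(* Both sides equal 2^(n(n+1)/2).

Tilings. Along one diagonal direction the cells of AD_n form rows A_0, B_0, A_1, ..., B_(n-1), A_n of n,
respectively n+1, cells, and tilings are perfect matchings between consecutive rows.  Let d_0 < ... < d_(i-1)
be the cells of A_i that are matched into B_(i-1).  By induction on i, the part below them can be matched
in 2^(i(i+1)/2) det[d_k choose j] ways.  The cells of A_i are matched to c_k in {d_k, d_k + 1}, and
summing the determinant row by row over these choices multiplies it by 2^i.  The remaining cells of B_(i-1)
leave exactly one free cell of A_(i-1) in each interval [c_k, c_(k+1)), and the sum over these choices is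
computed by the hockey-stick identity.

Determinant. It equals det(I + S S^T).  If r = 2 f - 1 is the generating function of the large Schroeder
numbers, then (1 + r(x) r(y)) / (1 - x y) is the sum over k of 2^(k+1) (x y)^k f(x)^(k+1) f(y)^(k+1), which
factors I + S S^T as U D U^T with U unitriangular and D = diag(2^n, ..., 2). *)

theory Submission
  imports Defs "HOL-Library.Disjoint_Sets"
    "HOL-Computational_Algebra.Formal_Power_Series"
begin

unbundle no vec_syntax
unbundle fps_syntax
no_notation vec_index (infixl "$" 100)

section \<open>Determinants of binomial coefficients\<close>

text \<open>Multilinearity in the rows: in the Leibniz expansion every product of row sums
  distributes into a sum over the choice functions \<open>f\<close>.\<close>

lemma det_sum_rows:
  fixes g :: "nat \<Rightarrow> 'b \<Rightarrow> nat \<Rightarrow> 'a :: comm_ring_1"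
  assumes "\<And>k. k < n \<Longrightarrow> finite (S k)"
  shows "(\<Sum>f\<in>Pi\<^sub>E {..<n} S. det (mat n n (\<lambda>(k, j). g k (f k) j))) =
    det (mat n n (\<lambda>(k, j). \<Sum>t\<in>S k. g k t j))"
proof -
  have 1: "det (mat n n (\<lambda>(k, j). h k j)) =
      (\<Sum>p | p permutes {0..<n}. signof p * (\<Prod>k<n. h k (p k)))" for h :: "nat \<Rightarrow> nat \<Rightarrow> 'a"
    by (auto simp: det_def'[of _ n] lessThan_atLeast0 intro!: sum.cong prod.cong)
  have 2: "(\<Sum>f\<in>Pi\<^sub>E {..<n} S. \<Prod>k<n. g k (f k) (p k)) = (\<Prod>k<n. \<Sum>t\<in>S k. g k t (p k))" for p
    using assms by (subst prod_sum_PiE) auto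
  show ?thesis
    unfolding 1 by (subst sum.swap) (simp add: sum_distrib_left[symmetric] 2)
qed

text \<open>Up to the factor 1 / (0! 1! ... (n-1)!), this is the Vandermonde determinant of the
  numbers \<open>x k\<close>, since the binomials are polynomials in \<open>x k\<close> of degree
  \<open>j\<close> with leading coefficient 1 / j!.\<close>

definition binom_det :: "nat \<Rightarrow> (nat \<Rightarrow> nat) \<Rightarrow> int" where
  "binom_det n x = det (mat n n (\<lambda>(k, j). int (x k choose j)))"

lemma binom_det_eq_0:
  assumes "x k = x l" "k < n" "l < n" "k \<noteq> l"
  shows "binom_det n x = 0"
  unfolding binom_det_def
  by (rule det_identical_rows[of _ n k l]) (use assms in \<open>auto simp: row_mat intro!: eq_vecI\<close>)

lemma binom_det_id: "binom_det n (\<lambda>k. k) = 1"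
proof -
  have "binom_det n (\<lambda>k. k) = (\<Prod>i = 0..<n. int (i choose i))"
    unfolding binom_det_def by (subst det_lower_triangular[of n]) (auto simp: prod_list_diag_prod)
  then show ?thesis by simp
qed

text \<open>By Pascal's rule, summing an entry over \<open>d k\<close> and \<open>d k + 1\<close>
  gives twice column \<open>j\<close> plus column \<open>j - 1\<close>. This is right multiplication
  by the bidiagonal matrix \<open>U\<close>, whose determinant is 2^n.\<close>

lemma sum_binom_det_step:
  "(\<Sum>c\<in>Pi\<^sub>E {..<n} (\<lambda>k. {d k, Suc (d k)}). binom_det n c) = 2 ^ n * binom_det n d"
proof -
  define U :: "int mat" where "U = mat n n (\<lambda>(l, j). if l = j then 2 else if Suc l = j then 1 else 0)"
  define M where "M = mat n n (\<lambda>(k, j). int (d k choose j))"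
  have "(\<Sum>c\<in>Pi\<^sub>E {..<n} (\<lambda>k. {d k, Suc (d k)}). binom_det n c) =
      det (mat n n (\<lambda>(k, j). \<Sum>t\<in>{d k, Suc (d k)}. int (t choose j)))"
    unfolding binom_det_def by (rule det_sum_rows) simp
  also have "mat n n (\<lambda>(k, j). \<Sum>t\<in>{d k, Suc (d k)}. int (t choose j)) = M * U"
  proof (rule eq_matI)
    fix k j assume kj: "k < dim_row (M * U)" "j < dim_col (M * U)"
    have "(M * U) $$ (k, j) =
        (\<Sum>l<n. int (d k choose l) * (if l = j then 2 else if Suc l = j then 1 else 0))"
      using kj by (auto simp: M_def U_def scalar_prod_def lessThan_atLeast0 intro!: sum.cong)
    also have "\<dots> = (\<Sum>l<n. if l = j then 2 * int (d k choose l) else 0) +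
        (\<Sum>l<n. if Suc l = j then int (d k choose l) else 0)"
      by (subst sum.distrib[symmetric]) (auto intro!: sum.cong)
    also have "(\<Sum>l<n. if Suc l = j then int (d k choose l) else 0) =
        (if j = 0 then 0 else int (d k choose (j - 1)))"
    proof (cases j)
      case (Suc i)
      then show ?thesis using kj by (auto simp: U_def)
    qed auto
    also have "(\<Sum>l<n. if l = j then 2 * int (d k choose l) else 0) = 2 * int (d k choose j)"
      using kj by (auto simp: U_def)
    also have "2 * int (d k choose j) + (if j = 0 then 0 else int (d k choose (j - 1))) =
        (\<Sum>t\<in>{d k, Suc (d k)}. int (t choose j))"
      by (cases j) auto
    finally show "mat n n (\<lambda>(k, j). \<Sum>t\<in>{d k, Suc (d k)}. int (t choose j)) $$ (k, j) =
        (M * U) $$ (k, j)" using kj by (simp add: M_def U_def)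
  qed (auto simp: M_def U_def)
  also have "det (M * U) = det M * det U"
    by (rule det_mult[of _ n]) (auto simp: M_def U_def)
  also have "det U = 2 ^ n"
    by (subst det_upper_triangular[of _ n]) (auto simp: U_def prod_list_diag_prod upper_triangular_def)
  finally show ?thesis by (simp add: M_def binom_det_def)
qed

lemma sum_choose_interval:
  assumes "a \<le> b"
  shows "(\<Sum>t\<in>{a..<b}. int (t choose j)) = int (b choose Suc j) - int (a choose Suc j)"
  using assms by (induction b rule: dec_induct) auto

text \<open>The hockey-stick identity makes row \<open>k\<close> the difference of the rows for
  \<open>c (Suc k)\<close> and \<open>c k\<close>, with columns shifted by one. The same differences
  arise from row operations on the larger binomial matrix, whose column 0 is constantly 1.\<close>

lemma sum_binom_det_interlacing:
  assumes "\<And>k. k < n \<Longrightarrow> c k \<le> c (Suc k)"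
  shows "(\<Sum>d\<in>Pi\<^sub>E {..<n} (\<lambda>k. {c k..<c (Suc k)}). binom_det n d) = binom_det (Suc n) c"
proof -
  \<comment> \<open>Left multiplication by \<open>L\<close> subtracts from each row its predecessor
    and keeps row 0. It turns the constant column 0 into the first unit vector, so that
    \<open>N\<close> remains as the lower right block.\<close>
  define L :: "int mat"
    where "L = mat (Suc n) (Suc n) (\<lambda>(k, l). if k = l then 1 else if k = Suc l then - 1 else 0)"
  define M where "M = mat (Suc n) (Suc n) (\<lambda>(k, j). int (c k choose j))"
  define N where "N = mat n n (\<lambda>(k, j). int (c (Suc k) choose Suc j) - int (c k choose Suc j))"
  define r where "r = mat 1 n (\<lambda>(k, j). int (c 0 choose Suc j))"
  have LM: "(L * M) $$ (k, j) = (if k = 0 then int (c 0 choose j) else int (c k choose j) - int (c (k - 1) choose j))"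
    if kj: "k < Suc n" "j < Suc n" for k j
  proof -
    have "(L * M) $$ (k, j) =
        (\<Sum>l<Suc n. (if k = l then 1 else if k = Suc l then - 1 else 0) * int (c l choose j))"
      using kj by (auto simp: M_def L_def scalar_prod_def lessThan_atLeast0 intro!: sum.cong)
    also have "\<dots> = (\<Sum>l<Suc n. if k = l then int (c l choose j) else 0) -
        (\<Sum>l<Suc n. if k = Suc l then int (c l choose j) else 0)"
      by (subst sum_subtractf[symmetric]) (auto intro!: sum.cong)
    also have "(\<Sum>l<Suc n. if k = l then int (c l choose j) else 0) = int (c k choose j)"
      using kj by auto
    also have "(\<Sum>l<Suc n. if k = Suc l then int (c l choose j) else 0) =
        (if k = 0 then 0 else int (c (k - 1) choose j))"
      using kj by (cases k) auto
    finally show ?thesis by (cases k) auto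
  qed
  have "(\<Sum>d\<in>Pi\<^sub>E {..<n} (\<lambda>k. {c k..<c (Suc k)}). binom_det n d) =
      det (mat n n (\<lambda>(k, j). \<Sum>t\<in>{c k..<c (Suc k)}. int (t choose j)))"
    unfolding binom_det_def by (rule det_sum_rows) simp
  also have "\<dots> = det N"
    unfolding N_def
    by (intro arg_cong[of _ _ det] cong_mat) (auto simp: sum_choose_interval assms)
  also have "\<dots> = det (four_block_mat (1\<^sub>m 1) r (0\<^sub>m n 1) N)"
    by (subst det_four_block_mat_lower_left_zero[of _ 1 _ n]) (auto simp: r_def N_def)
  also have "four_block_mat (1\<^sub>m 1) r (0\<^sub>m n 1) N = L * M"
  proof (rule eq_matI)
    fix k j assume "k < dim_row (L * M)" "j < dim_col (L * M)"
    then have kj: "k < Suc n" "j < Suc n" by (auto simp: L_def M_def)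
    show "four_block_mat (1\<^sub>m 1) r (0\<^sub>m n 1) N $$ (k, j) = (L * M) $$ (k, j)"
      using kj unfolding LM[OF kj] by (cases k; cases j) (auto simp: r_def N_def)
  qed (auto simp: L_def M_def r_def N_def)
  also have "det (L * M) = det L * det M"
    by (rule det_mult[of _ "Suc n"]) (auto simp: M_def L_def)
  also have "det L = 1"
    by (subst det_lower_triangular[of "Suc n"]) (auto simp: L_def prod_list_diag_prod)
  finally show ?thesis by (simp add: M_def binom_det_def)
qed

section \<open>Perfect matchings\<close>

text \<open>A matching is encoded as a partition of \<open>V\<close> into edges, each edge being the
  unordered pair of its ends. Irreflexivity of \<open>E\<close>, assumed in
  \<open>adjacency\<close>, rules out singleton blocks.\<close>

definition perfect_matchings :: "('v \<Rightarrow> 'v \<Rightarrow> bool) \<Rightarrow> 'v set \<Rightarrow> 'v set set set" where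
  "perfect_matchings E V =
     {P. (\<forall>e\<in>P. \<exists>x y. e = {x, y} \<and> E x y) \<and> disjoint P \<and> \<Union>P = V}"

abbreviation num_matchings :: "('v \<Rightarrow> 'v \<Rightarrow> bool) \<Rightarrow> 'v set \<Rightarrow> nat" where
  "num_matchings E V \<equiv> card (perfect_matchings E V)"

lemma finite_perfect_matchings:
  assumes "finite V"
  shows "finite (perfect_matchings E V)"
  by (rule finite_subset[of _ "Pow (Pow V)"]) (use assms in \<open>auto simp: perfect_matchings_def\<close>)

lemma num_matchings_empty [simp]: "num_matchings E {} = 1"
proof -
  have "perfect_matchings E {} = {{}}"
    by (auto simp: perfect_matchings_def)
  then show ?thesis by simp
qed

locale adjacency =
  fixes E :: "'v \<Rightarrow> 'v \<Rightarrow> bool"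
  assumes sym: "E x y \<Longrightarrow> E y x" and irrefl: "\<not> E x x"
begin

text \<open>The matchings are classified by the partner \<open>y\<close> of \<open>x\<close>.
  Deleting the edge between them is a bijection onto the matchings of
  \<open>W - {y}\<close>.\<close>

lemma num_matchings_insert:
  assumes W: "finite W" and x: "x \<notin> W"
  shows "num_matchings E (insert x W) = (\<Sum>y\<in>{y\<in>W. E x y}. num_matchings E (W - {y}))"
proof -
  let ?N = "{y\<in>W. E x y}"
  have "bij_betw (\<lambda>(y, P). insert {x, y} P) (SIGMA y:?N. perfect_matchings E (W - {y}))
      (perfect_matchings E (insert x W))"
  proof (rule bij_betwI')
    fix a b
    assume a: "a \<in> (SIGMA y:?N. perfect_matchings E (W - {y}))"
      and b: "b \<in> (SIGMA y:?N. perfect_matchings E (W - {y}))"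
    obtain y P where [simp]: "a = (y, P)" by force
    obtain z Q where [simp]: "b = (z, Q)" by force
    have P: "\<forall>e\<in>P. x \<notin> e" and Q: "\<forall>e\<in>Q. x \<notin> e"
      using a b x by (auto simp: perfect_matchings_def)
    have "y = z \<and> P = Q" if eq: "insert {x, y} P = insert {x, z} Q"
    proof -
      have "{x, y} \<in> insert {x, z} Q" unfolding eq[symmetric] by (rule insertI1)
      then have "y = z" using Q by (auto simp: doubleton_eq_iff)
      moreover have "{x, y} \<notin> P" "{x, z} \<notin> Q" using P Q by auto
      ultimately have "y = z" "P = Q" using eq by (auto simp: insert_ident)
      then show ?thesis by simp
    qed
    then show "((case a of (y, P) \<Rightarrow> insert {x, y} P) = (case b of (y, P) \<Rightarrow> insert {x, y} P)) = (a = b)"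
      by auto
  next
    fix a assume a: "a \<in> (SIGMA y:?N. perfect_matchings E (W - {y}))"
    obtain y P where [simp]: "a = (y, P)" by force
    have P: "\<forall>e\<in>P. x \<notin> e \<and> y \<notin> e"
      using a x by (auto simp: perfect_matchings_def)
    then have "disjoint (insert {x, y} P)"
      using a by (auto simp: perfect_matchings_def pairwise_insert disjnt_def)
    then show "(case a of (y, P) \<Rightarrow> insert {x, y} P) \<in> perfect_matchings E (insert x W)"
      using a by (auto simp: perfect_matchings_def)
  next
    fix R assume R: "R \<in> perfect_matchings E (insert x W)"
    then obtain e where e: "e \<in> R" "x \<in> e" by (auto simp: perfect_matchings_def)
    obtain a b where ab: "e = {a, b}" "E a b"
      using R e by (auto simp: perfect_matchings_def)
    obtain y where y: "e = {x, y}" "E x y"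
    proof (cases "x = a")
      case True
      then show ?thesis using ab that by blast
    next
      case False
      then have "x = b" using ab e by simp
      then show ?thesis using ab sym that[of a] by (simp add: insert_commute)
    qed
    have "y \<noteq> x" using y irrefl by auto
    have dis: "f \<inter> {x, y} = {}" if "f \<in> R - {{x, y}}" for f
      using R e y that by (auto simp: perfect_matchings_def pairwise_def disjnt_def)
    have "y \<in> W" using R e y \<open>y \<noteq> x\<close> by (auto simp: perfect_matchings_def)
    have U: "\<Union>R = insert x W" using R by (auto simp: perfect_matchings_def)
    have "\<Union>(R - {{x, y}}) = W - {y}"
    proof
      show "\<Union>(R - {{x, y}}) \<subseteq> W - {y}" using dis U by blast
      show "W - {y} \<subseteq> \<Union>(R - {{x, y}})" using U x by blast
    qed
    moreover have "disjoint (R - {{x, y}})"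
      using R by (auto simp: perfect_matchings_def pairwise_def)
    ultimately have "R - {{x, y}} \<in> perfect_matchings E (W - {y})"
      using R by (auto simp: perfect_matchings_def)
    moreover have "R = insert {x, y} (R - {{x, y}})" using e y by auto
    ultimately show "\<exists>a\<in>(SIGMA y:?N. perfect_matchings E (W - {y})).
        R = (case a of (y, P) \<Rightarrow> insert {x, y} P)"
      using y \<open>y \<in> W\<close> by (intro bexI[of _ "(y, R - {{x, y}})"]) auto
  qed
  from bij_betw_same_card[OF this] show ?thesis
    using W by (simp add: card_SigmaI finite_perfect_matchings)
qed

lemma num_matchings_forced:
  assumes "finite W" "x \<notin> W" "{z\<in>W. E x z} = {y}"
  shows "num_matchings E (insert x W) = num_matchings E (W - {y})"
  unfolding num_matchings_insert[OF assms(1,2)] assms(3) by simp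

text \<open>The vertices \<open>p k\<close> are matched one after another by
  \<open>num_matchings_insert\<close>. As no two of them are adjacent, all partners lie in
  \<open>W\<close>, and they form an injective choice function.\<close>

lemma num_matchings_peel:
  fixes p :: "nat \<Rightarrow> 'v" and W :: "'v set"
  assumes "finite W" "inj_on p {..<m}" "p ` {..<m} \<inter> W = {}"
    and "\<And>k l. k < m \<Longrightarrow> l < m \<Longrightarrow> \<not> E (p k) (p l)"
  shows "num_matchings E (W \<union> p ` {..<m}) =
    (\<Sum>f | f \<in> Pi\<^sub>E {..<m} (\<lambda>k. {w\<in>W. E (p k) w}) \<and> inj_on f {..<m}.
       num_matchings E (W - f ` {..<m}))"
  using assms
proof (induction m arbitrary: W)
  case 0
  then show ?case by simp
next
  case (Suc m)
  let ?S = "\<lambda>m W. {f \<in> Pi\<^sub>E {..<m} (\<lambda>k. {w\<in>W. E (p k) w}). inj_on f {..<m}}"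
  let ?N = "{w\<in>W. E (p m) w}"
  have "num_matchings E (W \<union> p ` {..<Suc m}) = num_matchings E (insert (p m) (W \<union> p ` {..<m}))"
    by (simp add: lessThan_Suc)
  also have "\<dots> = (\<Sum>y\<in>{y\<in>W \<union> p ` {..<m}. E (p m) y}. num_matchings E (W \<union> p ` {..<m} - {y}))"
  proof (rule num_matchings_insert)
    show "finite (W \<union> p ` {..<m})" using Suc.prems(1) by simp
    show "p m \<notin> W \<union> p ` {..<m}"
      using Suc.prems(2,3) by (simp add: lessThan_Suc)
  qed
  also have "{y\<in>W \<union> p ` {..<m}. E (p m) y} = ?N"
    using Suc.prems(4) by auto
  also have "(\<Sum>y\<in>?N. num_matchings E (W \<union> p ` {..<m} - {y})) =
      (\<Sum>y\<in>?N. num_matchings E ((W - {y}) \<union> p ` {..<m}))"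
  proof (rule sum.cong)
    fix y assume y: "y \<in> ?N"
    have "W \<union> p ` {..<m} - {y} = (W - {y}) \<union> p ` {..<m}"
      using y Suc.prems(3) by (auto simp: lessThan_Suc)
    then show "num_matchings E (W \<union> p ` {..<m} - {y}) = num_matchings E ((W - {y}) \<union> p ` {..<m})"
      by simp
  qed simp
  also have "\<dots> = (\<Sum>y\<in>?N. \<Sum>f\<in>?S m (W - {y}). num_matchings E (W - {y} - f ` {..<m}))"
  proof (rule sum.cong[OF refl], rule Suc.IH)
    fix y assume y: "y \<in> ?N"
    show "finite (W - {y})" using Suc.prems(1) by simp
    show "inj_on p {..<m}" using Suc.prems(2) by (simp add: lessThan_Suc)
    show "p ` {..<m} \<inter> (W - {y}) = {}" using Suc.prems(3) by (auto simp: lessThan_Suc)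
    show "\<not> E (p k) (p l)" if "k < m" "l < m" for k l
      using Suc.prems(4) that by simp
  qed
  also have "\<dots> = (\<Sum>(y, f)\<in>(SIGMA y:?N. ?S m (W - {y})). num_matchings E (W - {y} - f ` {..<m}))"
    by (rule sum.Sigma) (use Suc.prems(1) in \<open>simp_all add: finite_PiE\<close>)
  \<comment> \<open>A pair of a partner \<open>y\<close> for \<open>p m\<close> and a choice
    \<open>f\<close> for the others is one function with value \<open>y\<close> at \<open>m\<close>.
    Resetting that value to \<open>undefined\<close> restores extensionality.\<close>
  also have "\<dots> = (\<Sum>f\<in>?S (Suc m) W. num_matchings E (W - f ` {..<Suc m}))"
  proof (rule sum.reindex_bij_witness[of _ "\<lambda>f. (f m, f(m := undefined))" "\<lambda>(y, f). f(m := y)"],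
      goal_cases)
    case (1 a)
    then show ?case by (auto simp: PiE_def extensional_def)
  next
    case (2 a)
    then obtain y f where a: "a = (y, f)" "y \<in> ?N" "f \<in> ?S m (W - {y})" by auto
    have "inj_on (f(m := y)) {..<Suc m}"
      using a by (force simp: lessThan_Suc inj_on_def PiE_def Pi_def)
    then show ?case using a by (auto simp: PiE_def Pi_def extensional_def less_Suc_eq)
  next
    case (3 f)
    then show ?case by simp
  next
    case (4 f)
    then have f: "f \<in> Pi\<^sub>E {..<Suc m} (\<lambda>k. {w\<in>W. E (p k) w})" "inj_on f {..<Suc m}" by auto
    have "inj_on (f(m := undefined)) {..<m}"
      using f(2) by (auto simp: inj_on_def)
    moreover have "f k \<noteq> f m" if "k < m" for k
      using f(2) that by (auto simp: inj_on_def)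
    ultimately show ?case using f(1) by (auto simp: PiE_def Pi_def extensional_def)
  next
    case (5 a)
    then obtain y f where a: "a = (y, f)" "y \<in> ?N" "f \<in> ?S m (W - {y})" by auto
    have "W - (f(m := y)) ` {..<Suc m} = W - {y} - f ` {..<m}"
      by (auto simp: lessThan_Suc)
    then show ?case using a by simp
  qed
  finally show ?case .
qed

end

section \<open>The adjacency graph of the Aztec diamond\<close>

text \<open>\<open>ACell i j\<close> and \<open>BCell i j\<close> are the \<open>j\<close>-th cells of the rows \<open>A\<^sub>i\<close> and \<open>B\<^sub>i\<close>, where \<open>B\<^sub>i\<close>
  lies between \<open>A\<^sub>i\<close> and \<open>A\<^sub>i\<^sub>+\<^sub>1\<close>.\<close>

datatype cell = ACell nat nat | BCell nat nat

text \<open>Rows are staggered: cell \<open>j\<close> of an A-row touches the cells \<open>j\<close>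
  and \<open>j + 1\<close> of both neighbouring B-rows, which are therefore longer by one
  cell.\<close>

fun adj :: "cell \<Rightarrow> cell \<Rightarrow> bool" where
  "adj (ACell i j) (BCell i' j') \<longleftrightarrow> (i = i' \<or> i = Suc i') \<and> (j' = j \<or> j' = Suc j)"
| "adj (BCell i' j') (ACell i j) \<longleftrightarrow> (i = i' \<or> i = Suc i') \<and> (j' = j \<or> j' = Suc j)"
| "adj _ _ \<longleftrightarrow> False"

interpretation adj: adjacency adj
proof
  show "adj x y \<Longrightarrow> adj y x" for x y by (cases x; cases y) auto
  show "\<not> adj x x" for x by (cases x) auto
qed

section \<open>Forced chains and free cells within one row\<close>

text \<open>The only available neighbour of \<open>BCell i a\<close> is \<open>ACell i a\<close>.
  Once this pair is removed, the next B-cell is in the same position, so each B-cell takes the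
  A-cell of its own index.\<close>

lemma num_matchings_chain_up:
  assumes "finite W" and W: "\<And>j. j \<in> {a..<b} \<Longrightarrow> BCell i j \<notin> W \<and> (\<forall>w\<in>W. \<not> adj (BCell i j) w)"
  shows "num_matchings adj (W \<union> ACell i ` {a..<b} \<union> BCell i ` {a..<b}) = num_matchings adj W"
  using W
proof (induction "b - a" arbitrary: a)
  case 0
  then show ?case by simp
next
  case (Suc m)
  then have ab: "{a..<b} = insert a {Suc a..<b}" by auto
  let ?V = "W \<union> ACell i ` {Suc a..<b} \<union> BCell i ` {Suc a..<b}"
  have A: "ACell i a \<notin> ?V" using Suc.prems[of a] ab by auto
  have "W \<union> ACell i ` {a..<b} \<union> BCell i ` {a..<b} = insert (BCell i a) (insert (ACell i a) ?V)"
    unfolding ab by auto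
  also have "num_matchings adj \<dots> = num_matchings adj (insert (ACell i a) ?V - {ACell i a})"
    by (rule adj.num_matchings_forced) (use Suc.prems[of a] ab assms(1) in auto)
  also have "insert (ACell i a) ?V - {ACell i a} = ?V"
    using A by simp
  also have "num_matchings adj ?V = num_matchings adj W"
    using Suc by (intro Suc.hyps(1)) auto
  finally show ?case .
qed

text \<open>The mirror image, started at the right end: each \<open>BCell i j\<close> is forced onto
  \<open>ACell i (j - 1)\<close>.\<close>

lemma num_matchings_chain_down:
  assumes "a \<le> b" "finite W"
    and W: "\<And>j. j \<in> {a<..b} \<Longrightarrow> BCell i j \<notin> W \<and> (\<forall>w\<in>W. \<not> adj (BCell i j) w)"
  shows "num_matchings adj (W \<union> ACell i ` {a..<b} \<union> BCell i ` {a<..b}) = num_matchings adj W"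
  using assms(1) W
proof (induction b rule: dec_induct)
  case base
  then show ?case by simp
next
  case (step b)
  then have ab: "{a..<Suc b} = insert b {a..<b}" "{a<..Suc b} = insert (Suc b) {a<..b}" by auto
  let ?V = "W \<union> ACell i ` {a..<b} \<union> BCell i ` {a<..b}"
  have A: "ACell i b \<notin> ?V" using step.prems[of "Suc b"] ab by auto
  have "W \<union> ACell i ` {a..<Suc b} \<union> BCell i ` {a<..Suc b} =
      insert (BCell i (Suc b)) (insert (ACell i b) ?V)"
    unfolding ab by auto
  also have "num_matchings adj \<dots> = num_matchings adj (insert (ACell i b) ?V - {ACell i b})"
    by (rule adj.num_matchings_forced) (use step.prems[of "Suc b"] ab assms(2) in auto)
  also have "insert (ACell i b) ?V - {ACell i b} = ?V"
    using A by simp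
  also have "num_matchings adj ?V = num_matchings adj W"
    using step by (intro step.IH) auto
  finally show ?case .
qed

text \<open>There is one more A-cell than B-cells, so one A-cell \<open>d\<close> stays free for
  \<open>W\<close>. In the induction the last B-cell takes either the last A-cell, which leaves a
  shorter block, or the one before it; then the last A-cell is free and the rest is a forced
  chain.\<close>

lemma num_matchings_block:
  assumes "Suc a \<le> b" "finite W"
    and W: "\<And>j. j \<in> {a<..<b} \<Longrightarrow> BCell i j \<notin> W \<and> (\<forall>w\<in>W. \<not> adj (BCell i j) w)"
  shows "num_matchings adj (W \<union> ACell i ` {a..<b} \<union> BCell i ` {a<..<b}) =
    (\<Sum>d\<in>{a..<b}. num_matchings adj (insert (ACell i d) W))"
  using assms(1) W
proof (induction b rule: dec_induct)
  case base
  have "{a<..<Suc a} = {}" by auto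
  then show ?case by simp
next
  case (step b)
  obtain e where e: "b = Suc e" "a \<le> e" using step.hyps(1) by (cases b) auto
  have ab: "{a..<Suc b} = insert b (insert e {a..<e})" "{a<..<Suc b} = insert b {a<..e}"
    "{a..<b} = insert e {a..<e}" "{a<..<b} = {a<..e}"
    using e by auto
  define V where "V = W \<union> ACell i ` {a..<Suc b} \<union> BCell i ` {a<..<b}"
  have ne: "b \<noteq> e" using e(1) by simp
  have b: "BCell i b \<notin> W" "\<And>w. w \<in> W \<Longrightarrow> \<not> adj (BCell i b) w"
    using step.prems[of b] step.hyps(1) by auto
  have A: "ACell i b \<notin> W" "ACell i e \<notin> W" using b(2) e(1) by force+
  have finV: "finite V" and bV: "BCell i b \<notin> V" using b(1) assms(2) by (auto simp: V_def)
  have nb: "{y\<in>V. adj (BCell i b) y} = {ACell i b, ACell i e}"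
  proof
    show "{y\<in>V. adj (BCell i b) y} \<subseteq> {ACell i b, ACell i e}"
    proof
      fix y assume "y \<in> {y\<in>V. adj (BCell i b) y}"
      then have y: "y \<in> V" "adj (BCell i b) y" by simp_all
      have "y \<notin> W" using b(2) y(2) by blast
      moreover have "y \<notin> BCell i ` {a<..<b}" using y(2) by force
      ultimately obtain j where "y = ACell i j" using y(1) by (auto simp: V_def)
      then show "y \<in> {ACell i b, ACell i e}" using y(2) e(1) by force
    qed
    have "ACell i b \<in> V" "ACell i e \<in> V"
      using e step.hyps(1) by (auto simp: V_def)
    moreover have "adj (BCell i b) (ACell i b)" "adj (BCell i b) (ACell i e)"
      using e(1) by simp_all
    ultimately show "{ACell i b, ACell i e} \<subseteq> {y\<in>V. adj (BCell i b) y}" by simp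
  qed
  have "W \<union> ACell i ` {a..<Suc b} \<union> BCell i ` {a<..<Suc b} = insert (BCell i b) V"
    unfolding V_def ab by auto
  then have "num_matchings adj (W \<union> ACell i ` {a..<Suc b} \<union> BCell i ` {a<..<Suc b}) =
      num_matchings adj (V - {ACell i b}) + num_matchings adj (V - {ACell i e})"
    by (simp add: adj.num_matchings_insert[OF finV bV] nb ne del: adj.simps)
  moreover have "V - {ACell i b} = W \<union> ACell i ` {a..<b} \<union> BCell i ` {a<..<b}"
    unfolding V_def using A by auto
  moreover have "num_matchings adj (W \<union> ACell i ` {a..<b} \<union> BCell i ` {a<..<b}) =
      (\<Sum>d\<in>{a..<b}. num_matchings adj (insert (ACell i d) W))"
    using step.prems by (intro step.IH) simp
  moreover have "V - {ACell i e} = insert (ACell i b) W \<union> ACell i ` {a..<e} \<union> BCell i ` {a<..e}"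
  proof -
    have "ACell i e \<notin> ACell i ` {a..<e}" "ACell i e \<notin> BCell i ` {a<..e}"
      by auto
    then show ?thesis
      unfolding V_def ab using A ne by auto
  qed
  moreover have "num_matchings adj (insert (ACell i b) W \<union> ACell i ` {a..<e} \<union> BCell i ` {a<..e}) =
      num_matchings adj (insert (ACell i b) W)"
  proof (rule num_matchings_chain_down)
    show "a \<le> e" "finite (insert (ACell i b) W)" using e assms(2) by auto
    show "BCell i j \<notin> insert (ACell i b) W \<and> (\<forall>w\<in>insert (ACell i b) W. \<not> adj (BCell i j) w)"
      if "j \<in> {a<..e}" for j
      using step.prems[of j] e that by auto
  qed
  moreover have "{a..<Suc b} = insert b {a..<b}" "b \<notin> {a..<b}" using step.hyps(1) by auto
  ultimately show ?case by simp
qed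

lemma sum_PiE_lessThan_Suc:
  "(\<Sum>d\<in>Pi\<^sub>E {..<Suc m} S. h d) = (\<Sum>e\<in>S m. \<Sum>d\<in>Pi\<^sub>E {..<m} S. h (d(m := e)))"
proof -
  have inj: "inj_on (\<lambda>(e, d). d(m := e)) (S m \<times> Pi\<^sub>E {..<m} S)"
    by (rule inj_combinator) simp
  show ?thesis
    unfolding lessThan_Suc PiE_insert_eq sum.reindex[OF inj] sum.cartesian_product
    by (simp add: case_prod_unfold)
qed

text \<open>The missing B-cells \<open>c k\<close> are the only cells of the row that could link
  neighbouring blocks. Hence the blocks choose their free A-cells independently, and the last one
  can be split off by \<open>num_matchings_block\<close>.\<close>

lemma num_matchings_blocks:
  assumes "finite W" and c: "\<And>k l. k < l \<Longrightarrow> l \<le> m \<Longrightarrow> c k < c l"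
    and W: "\<And>k j. k < m \<Longrightarrow> j \<in> {c k<..<c (Suc k)} \<Longrightarrow>
      BCell i j \<notin> W \<and> (\<forall>w\<in>W. \<not> adj (BCell i j) w)"
  shows "num_matchings adj
      (W \<union> (\<Union>k<m. ACell i ` {c k..<c (Suc k)} \<union> BCell i ` {c k<..<c (Suc k)})) =
    (\<Sum>d\<in>Pi\<^sub>E {..<m} (\<lambda>k. {c k..<c (Suc k)}). num_matchings adj (W \<union> ACell i ` d ` {..<m}))"
  using assms
proof (induction m arbitrary: W)
  case 0
  then show ?case by simp
next
  case (Suc m)
  let ?U = "\<Union>k<m. ACell i ` {c k..<c (Suc k)} \<union> BCell i ` {c k<..<c (Suc k)}"
  let ?P = "Pi\<^sub>E {..<m} (\<lambda>k. {c k..<c (Suc k)})"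
  have le: "c (Suc k) \<le> c m" if "k < m" for k
    using Suc.prems(2)[of "Suc k" m] that by (cases "Suc k = m") auto
  have *: "j < c m" if "k < m" "j < c (Suc k)" for k j
    using le[OF that(1)] that(2) by linarith
  have split: "W \<union> (\<Union>k<Suc m. ACell i ` {c k..<c (Suc k)} \<union> BCell i ` {c k<..<c (Suc k)}) =
      W \<union> ?U \<union> ACell i ` {c m..<c (Suc m)} \<union> BCell i ` {c m<..<c (Suc m)}"
    by (simp only: lessThan_Suc UN_insert Un_ac)
  have "num_matchings adj
      (W \<union> (\<Union>k<Suc m. ACell i ` {c k..<c (Suc k)} \<union> BCell i ` {c k<..<c (Suc k)})) =
      (\<Sum>e\<in>{c m..<c (Suc m)}. num_matchings adj (insert (ACell i e) (W \<union> ?U)))"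
    unfolding split
  proof (rule num_matchings_block)
    show "Suc (c m) \<le> c (Suc m)" using Suc.prems(2)[of m "Suc m"] by simp
    show "finite (W \<union> ?U)" using Suc.prems(1) by simp
    show "BCell i j \<notin> W \<union> ?U \<and> (\<forall>w\<in>W \<union> ?U. \<not> adj (BCell i j) w)"
      if "j \<in> {c m<..<c (Suc m)}" for j
    proof -
      have "\<not> (c k \<le> l \<and> l < c (Suc k))" if "k < m" "j \<le> Suc l" for k l
        using le[OF that(1)] that(2) \<open>j \<in> {c m<..<c (Suc m)}\<close> by auto
      then show ?thesis using Suc.prems(3)[of m j] that by auto
    qed
  qed
  also have "\<dots> = (\<Sum>e\<in>{c m..<c (Suc m)}.
      \<Sum>d\<in>?P. num_matchings adj (insert (ACell i e) W \<union> ACell i ` d ` {..<m}))"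
  proof (rule sum.cong[OF refl])
    fix e assume e: "e \<in> {c m..<c (Suc m)}"
    show "num_matchings adj (insert (ACell i e) (W \<union> ?U)) =
        (\<Sum>d\<in>?P. num_matchings adj (insert (ACell i e) W \<union> ACell i ` d ` {..<m}))"
      unfolding Un_insert_left[symmetric]
    proof (rule Suc.IH)
      show "finite (insert (ACell i e) W)" using Suc.prems(1) by simp
      show "c k < c l" if "k < l" "l \<le> m" for k l
        by (rule Suc.prems(2)) (use that in linarith)+
      show "BCell i j \<notin> insert (ACell i e) W \<and> (\<forall>w\<in>insert (ACell i e) W. \<not> adj (BCell i j) w)"
        if "k < m" "j \<in> {c k<..<c (Suc k)}" for k j
      proof -
        have "j < e" using *[OF that(1)] that(2) e by fastforce
        then show ?thesis using Suc.prems(3)[OF less_SucI[OF that(1)] that(2)] by auto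
      qed
    qed
  qed
  also have "\<dots> = (\<Sum>d\<in>Pi\<^sub>E {..<Suc m} (\<lambda>k. {c k..<c (Suc k)}).
      num_matchings adj (W \<union> ACell i ` d ` {..<Suc m}))"
  proof -
    have "insert (ACell i e) W \<union> ACell i ` d ` {..<m} = W \<union> ACell i ` (d(m := e)) ` {..<Suc m}"
      for e d by (auto simp: lessThan_Suc)
    then show ?thesis by (simp only: sum_PiE_lessThan_Suc)
  qed
  finally show ?case .
qed

section \<open>Recursion over the rows of the diamond\<close>

text \<open>The rows \<open>A\<^sub>0, B\<^sub>0, \<dots>, A\<^sub>i\<^sub>-\<^sub>1, B\<^sub>i\<^sub>-\<^sub>1\<close> of the Aztec diamond of order \<open>n\<close>.\<close>

definition aztec_rows :: "nat \<Rightarrow> nat \<Rightarrow> cell set" where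
  "aztec_rows n i = (\<Union>r<i. ACell r ` {..<n} \<union> BCell r ` {..n})"

lemma ACell_in_aztec_rows [simp]: "ACell r j \<in> aztec_rows n i \<longleftrightarrow> r < i \<and> j < n"
  and BCell_in_aztec_rows [simp]: "BCell r j \<in> aztec_rows n i \<longleftrightarrow> r < i \<and> j \<le> n"
  by (auto simp: aztec_rows_def)

lemma finite_aztec_rows: "finite (aztec_rows n i)"
  by (auto simp: aztec_rows_def)

lemma aztec_rows_Suc: "aztec_rows n (Suc i) = aztec_rows n i \<union> ACell i ` {..<n} \<union> BCell i ` {..n}"
  by (auto simp: aztec_rows_def lessThan_Suc)

lemma less_of_less_Suc:
  fixes c :: "nat \<Rightarrow> nat"
  assumes "\<And>k. Suc k < m \<Longrightarrow> c k < c (Suc k)" "k < l" "l < m"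
  shows "c k < c l"
  using assms(2,3)
proof (induction l)
  case (Suc l)
  then show ?case using assms(1)[of l] by (cases "k = l") auto
qed simp

lemma UN_consecutive_intervals:
  fixes c :: "nat \<Rightarrow> nat"
  assumes "\<And>k. k < m \<Longrightarrow> c k < c (Suc k)"
  shows "c 0 \<le> c m" "(\<Union>k<m. {c k..<c (Suc k)}) = {c 0..<c m}"
    "(\<Union>k<m. {c k<..<c (Suc k)}) = {c 0..<c m} - c ` {..<m}"
proof -
  have "c 0 \<le> c m \<and> (\<Union>k<m. {c k..<c (Suc k)}) = {c 0..<c m} \<and>
      (\<Union>k<m. {c k<..<c (Suc k)}) = {c 0..<c m} - c ` {..<m}"
    using assms
  proof (induction m)
    case (Suc m)
    have IH: "c 0 \<le> c m" "(\<Union>k<m. {c k..<c (Suc k)}) = {c 0..<c m}"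
      "(\<Union>k<m. {c k<..<c (Suc k)}) = {c 0..<c m} - c ` {..<m}"
      using Suc by auto
    have lt: "c m < c (Suc m)" using Suc.prems by simp
    have "c k < c m" if "k < m" for k
      by (rule less_of_less_Suc[of "Suc m"]) (use Suc.prems that in auto)
    then have "c ` {..<m} \<inter> {c m<..} = {}" by (auto dest: less_asym)
    then have "{c 0..<c (Suc m)} - c ` {..<Suc m} = ({c 0..<c m} - c ` {..<m}) \<union> {c m<..<c (Suc m)}"
      using lt IH(1) by (auto simp: lessThan_Suc not_less)
    moreover have "{c 0..<c (Suc m)} = {c 0..<c m} \<union> {c m..<c (Suc m)}"
      using lt IH(1) by auto
    ultimately show ?case
      using IH lt by (simp add: lessThan_Suc Un_commute)
  qed simp
  then show "c 0 \<le> c m" "(\<Union>k<m. {c k..<c (Suc k)}) = {c 0..<c m}"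
    "(\<Union>k<m. {c k<..<c (Suc k)}) = {c 0..<c m} - c ` {..<m}"
    by auto
qed

text \<open>With the cells \<open>c 0\<close>, ..., \<open>c i\<close> of row
  \<open>B\<^sub>i\<close> already used, its other cells must be matched into
  \<open>A\<^sub>i\<close>. This is forced left of \<open>c 0\<close> and right of
  \<open>c i\<close>, and each interval between consecutive \<open>c k\<close> leaves one free
  A-cell, so that \<open>d\<close> interlaces with \<open>c\<close>.\<close>

lemma num_matchings_row:
  assumes c: "\<And>k. k < i \<Longrightarrow> c k < c (Suc k)" and n: "c i \<le> n"
  shows "num_matchings adj
      (aztec_rows n i \<union> ACell i ` {..<n} \<union> BCell i ` ({..n} - c ` {..<Suc i})) =
    (\<Sum>d\<in>Pi\<^sub>E {..<i} (\<lambda>k. {c k..<c (Suc k)}).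
      num_matchings adj (aztec_rows n i \<union> ACell i ` d ` {..<i}))"
proof -
  have ivl: "c 0 \<le> c i" "(\<Union>k<i. {c k..<c (Suc k)}) = {c 0..<c i}"
    "(\<Union>k<i. {c k<..<c (Suc k)}) = {c 0..<c i} - c ` {..<i}"
    using UN_consecutive_intervals[of i c] c by simp_all
  define U where "U = (\<Union>k<i. ACell i ` {c k..<c (Suc k)} \<union> BCell i ` {c k<..<c (Suc k)})"
  define V where "V = aztec_rows n i \<union> U \<union> ACell i ` {c i..<n} \<union> BCell i ` {c i<..n}"
  have U: "U = ACell i ` {c 0..<c i} \<union> BCell i ` ({c 0..<c i} - c ` {..<i})"
    unfolding U_def UN_Un_distrib image_UN[symmetric] ivl by simp
  have mono: "c k < c l" if "k < l" "l \<le> i" for k l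
    by (rule less_of_less_Suc[of "Suc i"]) (use c that in auto)
  have ck: "c 0 \<le> c k" "c k \<le> c i" if "k \<le> i" for k
    using mono[of 0 k] mono[of k i] that by (cases "k = 0"; cases "k = i"; force)+
  have A: "{..<n} = {0..<c 0} \<union> {c 0..<c i} \<union> {c i..<n}"
    using ivl(1) n by auto
  have "{c 0..<c i} - c ` {..<Suc i} = {c 0..<c i} - c ` {..<i}"
    by (auto simp: lessThan_Suc)
  moreover have "{0..<c 0} \<inter> c ` {..<Suc i} = {}" "{c i<..n} \<inter> c ` {..<Suc i} = {}"
    using ck by (force simp: not_less less_Suc_eq_le)+
  moreover have "c i \<in> c ` {..<Suc i}" by simp
  moreover have "{..n} = {0..<c 0} \<union> {c 0..<c i} \<union> {c i} \<union> {c i<..n}"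
    using ivl(1) n by auto
  ultimately have B: "{..n} - c ` {..<Suc i} = {0..<c 0} \<union> ({c 0..<c i} - c ` {..<i}) \<union> {c i<..n}"
    by blast
  have "aztec_rows n i \<union> ACell i ` {..<n} \<union> BCell i ` ({..n} - c ` {..<Suc i}) =
      V \<union> ACell i ` {0..<c 0} \<union> BCell i ` {0..<c 0}"
    unfolding A B V_def U image_Un by (simp only: Un_ac)
  moreover have "num_matchings adj (V \<union> ACell i ` {0..<c 0} \<union> BCell i ` {0..<c 0}) =
      num_matchings adj V"
    by (rule num_matchings_chain_up)
      (use ivl(1) in \<open>auto simp: V_def U aztec_rows_def\<close>)
  moreover have "num_matchings adj V = num_matchings adj (aztec_rows n i \<union> U)"
    unfolding V_def
    by (rule num_matchings_chain_down)
      (use n ivl(1) in \<open>auto simp: U aztec_rows_def\<close>)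
  moreover have "num_matchings adj (aztec_rows n i \<union> U) =
      (\<Sum>d\<in>Pi\<^sub>E {..<i} (\<lambda>k. {c k..<c (Suc k)}).
        num_matchings adj (aztec_rows n i \<union> ACell i ` d ` {..<i}))"
    unfolding U_def
    by (rule num_matchings_blocks) (use mono in \<open>auto simp: aztec_rows_def\<close>)
  ultimately show ?thesis by simp
qed

text \<open>Only the neighbours in \<open>B\<^sub>i\<close> are present for the cells
  \<open>d k\<close> of \<open>A\<^sub>i\<^sub>+\<^sub>1\<close>. Injectivity matters because
  \<open>d k + 1\<close> may equal \<open>d (k + 1)\<close>.\<close>

lemma num_matchings_aztec_step:
  assumes d: "\<And>k. k < i \<Longrightarrow> d k < d (Suc k)" and n: "d i < n"
  shows "num_matchings adj (aztec_rows n (Suc i) \<union> ACell (Suc i) ` d ` {..<Suc i}) =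
    (\<Sum>c | c \<in> Pi\<^sub>E {..<Suc i} (\<lambda>k. {d k, Suc (d k)}) \<and> inj_on c {..<Suc i}.
      num_matchings adj
        (aztec_rows n i \<union> ACell i ` {..<n} \<union> BCell i ` ({..n} - c ` {..<Suc i})))"
proof -
  let ?W = "aztec_rows n (Suc i)" and ?p = "\<lambda>k. ACell (Suc i) (d k)"
  have mono: "d k < d l" if "k < l" "l \<le> i" for k l
    by (rule less_of_less_Suc[of "Suc i"]) (use d that in auto)
  have dn: "d k < n" if "k < Suc i" for k
    using mono[of k i] n that by (cases "k = i") auto
  have "inj_on d {..<Suc i}"
    by (rule linorder_inj_onI) (use mono in force)+
  then have inj: "inj_on ?p {..<Suc i}" by (auto simp: inj_on_def)
  have N: "{w\<in>?W. adj (?p k) w} = BCell i ` {d k, Suc (d k)}" if "k < Suc i" for k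
  proof (rule Set.set_eqI)
    show "w \<in> {w\<in>?W. adj (?p k) w} \<longleftrightarrow> w \<in> BCell i ` {d k, Suc (d k)}" for w
      using dn[OF that] by (cases w) auto
  qed
  have "num_matchings adj (?W \<union> ?p ` {..<Suc i}) =
    (\<Sum>f | f \<in> Pi\<^sub>E {..<Suc i} (\<lambda>k. {w\<in>?W. adj (?p k) w}) \<and> inj_on f {..<Suc i}.
       num_matchings adj (?W - f ` {..<Suc i}))"
    by (rule adj.num_matchings_peel[OF finite_aztec_rows inj]) (auto simp: aztec_rows_def)
  also have "Pi\<^sub>E {..<Suc i} (\<lambda>k. {w\<in>?W. adj (?p k) w}) =
      Pi\<^sub>E {..<Suc i} (\<lambda>k. BCell i ` {d k, Suc (d k)})"
    by (rule PiE_cong) (use N in auto)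
  also have "(\<Sum>f | f \<in> Pi\<^sub>E {..<Suc i} (\<lambda>k. BCell i ` {d k, Suc (d k)}) \<and> inj_on f {..<Suc i}.
       num_matchings adj (?W - f ` {..<Suc i})) =
    (\<Sum>c | c \<in> Pi\<^sub>E {..<Suc i} (\<lambda>k. {d k, Suc (d k)}) \<and> inj_on c {..<Suc i}.
      num_matchings adj
        (aztec_rows n i \<union> ACell i ` {..<n} \<union> BCell i ` ({..n} - c ` {..<Suc i})))"
  \<comment> \<open>Choices of cells in row \<open>B\<^sub>i\<close> are translated into choices of
    their indices. The inverse of the injective constructor \<open>BCell i\<close> recovers the
    index.\<close>
  proof (rule sum.reindex_bij_witness[of _ "\<lambda>c. \<lambda>k\<in>{..<Suc i}. BCell i (c k)"
        "\<lambda>f. \<lambda>k\<in>{..<Suc i}. the_inv (BCell i) (f k)"], goal_cases)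
    case (1 f)
    then show ?case by (auto simp: fun_eq_iff PiE_def Pi_def extensional_def the_inv_f_f inj_def)
  next
    case (2 f)
    then have f: "f k \<in> BCell i ` {d k, Suc (d k)}" if "k < Suc i" for k
      using that by (auto simp: PiE_def Pi_def)
    have inv: "the_inv (BCell i) (BCell i j) = j" for j
      by (simp add: the_inv_f_f inj_def)
    have Bf: "BCell i (the_inv (BCell i) (f k)) = f k" if "k < Suc i" for k
      using f[OF that] inv by auto
    have "the_inv (BCell i) (f k) \<in> {d k, Suc (d k)}" if "k < Suc i" for k
      using f[OF that] inv by auto
    then have "(\<lambda>k\<in>{..<Suc i}. the_inv (BCell i) (f k)) \<in> Pi\<^sub>E {..<Suc i} (\<lambda>k. {d k, Suc (d k)})"
      by (intro restrict_PiE_iff[THEN iffD2] ballI) (simp only: lessThan_iff)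
    moreover have "inj_on (\<lambda>k\<in>{..<Suc i}. the_inv (BCell i) (f k)) {..<Suc i}"
    proof (rule inj_onI)
      fix k l assume kl: "k \<in> {..<Suc i}" "l \<in> {..<Suc i}"
        and eq: "(\<lambda>k\<in>{..<Suc i}. the_inv (BCell i) (f k)) k =
          (\<lambda>k\<in>{..<Suc i}. the_inv (BCell i) (f k)) l"
      from eq have "the_inv (BCell i) (f k) = the_inv (BCell i) (f l)"
        unfolding restrict_apply'[OF kl(1)] restrict_apply'[OF kl(2)] .
      then have "BCell i (the_inv (BCell i) (f k)) = BCell i (the_inv (BCell i) (f l))"
        by (rule arg_cong)
      then have "f k = f l" using kl by (simp only: Bf lessThan_iff)
      then show "k = l" using 2 kl by (auto dest: inj_onD)
    qed
    ultimately show ?case by blast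
  next
    case (3 c)
    then show ?case by (auto simp: fun_eq_iff PiE_def Pi_def extensional_def the_inv_f_f inj_def)
  next
    case (4 c)
    then show ?case by (auto simp: inj_on_def)
  next
    case (5 f)
    then have f: "f k \<in> BCell i ` {d k, Suc (d k)}" if "k < Suc i" for k
      using that by (auto simp: PiE_def Pi_def)
    have inv: "the_inv (BCell i) (BCell i j) = j" for j
      by (simp add: the_inv_f_f inj_def)
    have "BCell i (the_inv (BCell i) (f k)) = f k" if "k < Suc i" for k
      using f[OF that] inv by auto
    then have "f ` {..<Suc i} = BCell i ` (\<lambda>k\<in>{..<Suc i}. the_inv (BCell i) (f k)) ` {..<Suc i}"
      unfolding image_image by (intro image_cong) simp_all
    then have "?W - f ` {..<Suc i} = aztec_rows n i \<union> ACell i ` {..<n} \<union>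
        BCell i ` ({..n} - (\<lambda>k\<in>{..<Suc i}. the_inv (BCell i) (f k)) ` {..<Suc i})"
      by (auto simp: aztec_rows_Suc)
    then show ?case by simp
  qed
  finally show ?thesis by (simp only: image_image)
qed

text \<open>For each injective choice \<open>c\<close>, the induction hypothesis summed over the
  interlacing \<open>x\<close> gives \<open>binom_det (Suc i) c\<close>. Summation over
  \<open>c\<close> then contributes the new factor 2^(i+1).\<close>

lemma num_matchings_aztec_rows:
  assumes "\<And>k. Suc k < i \<Longrightarrow> d k < d (Suc k)" "\<And>k. k < i \<Longrightarrow> d k < n"
  shows "int (num_matchings adj (aztec_rows n i \<union> ACell i ` d ` {..<i})) =
    2 ^ (i * (i + 1) div 2) * binom_det i d"
  using assms
proof (induction i arbitrary: d)
  case 0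
  then show ?case by (simp add: aztec_rows_def binom_det_def)
next
  case (Suc i)
  let ?P = "Pi\<^sub>E {..<Suc i} (\<lambda>k. {d k, Suc (d k)})"
  let ?e = "2 ^ (i * (i + 1) div 2) :: int"
  have row: "int (num_matchings adj
      (aztec_rows n i \<union> ACell i ` {..<n} \<union> BCell i ` ({..n} - c ` {..<Suc i}))) =
      ?e * binom_det (Suc i) c" if c: "c \<in> ?P" and inj: "inj_on c {..<Suc i}" for c
  proof -
    have ck: "c k = d k \<or> c k = Suc (d k)" if "k < Suc i" for k
      using c that by (auto simp: PiE_def Pi_def)
    \<comment> \<open>As \<open>d k < d (k + 1)\<close>, moving right by at most one can only create
      a tie, which injectivity excludes.\<close>
    have mono: "c k < c (Suc k)" if "k < i" for k
    proof -
      have "c k \<noteq> c (Suc k)" using inj_onD[OF inj, of k "Suc k"] that by auto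
      then show ?thesis using ck[of k] ck[of "Suc k"] Suc.prems(1)[of k] that by auto
    qed
    have cn: "c k \<le> n" if "k < Suc i" for k
      using ck[OF that] Suc.prems(2)[OF that] by auto
    have "int (num_matchings adj
      (aztec_rows n i \<union> ACell i ` {..<n} \<union> BCell i ` ({..n} - c ` {..<Suc i}))) =
      (\<Sum>x\<in>Pi\<^sub>E {..<i} (\<lambda>k. {c k..<c (Suc k)}).
        int (num_matchings adj (aztec_rows n i \<union> ACell i ` x ` {..<i})))"
      using num_matchings_row[of i c n] mono cn[of i] by simp
    also have "\<dots> = (\<Sum>x\<in>Pi\<^sub>E {..<i} (\<lambda>k. {c k..<c (Suc k)}). ?e * binom_det i x)"
    proof (rule sum.cong[OF refl], rule Suc.IH)
      fix x assume "x \<in> Pi\<^sub>E {..<i} (\<lambda>k. {c k..<c (Suc k)})"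
      then have x: "c k \<le> x k" "x k < c (Suc k)" if "k < i" for k
        using that by (auto simp: PiE_def Pi_def)
      show "x k < x (Suc k)" if "Suc k < i" for k
        using x(2)[of k] x(1)[of "Suc k"] that by simp
      show "x k < n" if "k < i" for k
        using x(2)[OF that] cn[of "Suc k"] that by simp
    qed
    also have "\<dots> = ?e * binom_det (Suc i) c"
      unfolding sum_distrib_left[symmetric]
      by (subst sum_binom_det_interlacing) (use mono in \<open>auto intro: less_imp_le\<close>)
    finally show ?thesis .
  qed
  have "int (num_matchings adj (aztec_rows n (Suc i) \<union> ACell (Suc i) ` d ` {..<Suc i})) =
      (\<Sum>c | c \<in> ?P \<and> inj_on c {..<Suc i}. int (num_matchings adj
      (aztec_rows n i \<union> ACell i ` {..<n} \<union> BCell i ` ({..n} - c ` {..<Suc i}))))"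
    using num_matchings_aztec_step[of i d n] Suc.prems by simp
  also have "\<dots> = (\<Sum>c | c \<in> ?P \<and> inj_on c {..<Suc i}. ?e * binom_det (Suc i) c)"
    by (rule sum.cong) (use row in auto)
  \<comment> \<open>Non-injective choices may be added freely, because their determinants have two
    equal rows. This makes the sum a full product of choices, as \<open>sum_binom_det_step\<close>
    requires.\<close>
  also have "\<dots> = (\<Sum>c\<in>?P. ?e * binom_det (Suc i) c)"
  proof (rule sum.mono_neutral_left)
    show "finite ?P" by (intro finite_PiE) auto
    show "\<forall>c\<in>?P - {c \<in> ?P. inj_on c {..<Suc i}}. ?e * binom_det (Suc i) c = 0"
      by (auto simp: inj_on_def intro!: binom_det_eq_0)
  qed auto
  also have "\<dots> = ?e * 2 ^ Suc i * binom_det (Suc i) d"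
    unfolding sum_distrib_left[symmetric] sum_binom_det_step by simp
  also have "?e * 2 ^ Suc i = 2 ^ (Suc i * (Suc i + 1) div 2)"
  proof -
    have "Suc i * (Suc i + 1) = i * (i + 1) + Suc i * 2" by (simp add: algebra_simps)
    then have "Suc i * (Suc i + 1) div 2 = i * (i + 1) div 2 + Suc i" by simp
    then show ?thesis by (simp only: power_add)
  qed
  finally show ?case .
qed

text \<open>All cells of the last row \<open>A\<^sub>n\<close> are matched into the preceding B-row,
  so \<open>d\<close> is the identity and the binomial matrix is unitriangular.\<close>

corollary num_matchings_aztec:
  "int (num_matchings adj (aztec_rows n n \<union> ACell n ` {..<n})) = 2 ^ (n * (n + 1) div 2)"
  using num_matchings_aztec_rows[of n "\<lambda>k. k" n] by (simp add: binom_det_id)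

section \<open>Domino tilings as perfect matchings\<close>

lemma perfect_matchings_image_iff:
  assumes f: "inj_on f V" and E: "\<And>x y. x \<in> V \<Longrightarrow> y \<in> V \<Longrightarrow> E' (f x) (f y) \<longleftrightarrow> E x y"
    and P: "P \<subseteq> Pow V"
  shows "image f ` P \<in> perfect_matchings E' (f ` V) \<longleftrightarrow> P \<in> perfect_matchings E V"
proof -
  have "(\<exists>x y. f ` e = {x, y} \<and> E' x y) \<longleftrightarrow> (\<exists>x y. e = {x, y} \<and> E x y)" if "e \<in> P" for e
  proof
    assume "\<exists>x y. f ` e = {x, y} \<and> E' x y"
    then obtain x y where xy: "f ` e = {x, y}" "E' x y" by blast
    then obtain a b where ab: "a \<in> e" "b \<in> e" "x = f a" "y = f b" by (metis imageE insertCI)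
    have "e \<subseteq> V" using that P by blast
    have "f ` e = f ` {a, b}" using xy ab by simp
    then have "e = {a, b}"
      using inj_on_image_eq_iff[OF f, of e "{a, b}"] ab \<open>e \<subseteq> V\<close> by blast
    moreover have "E a b" using E[of a b] ab xy(2) \<open>e \<subseteq> V\<close> by blast
    ultimately show "\<exists>x y. e = {x, y} \<and> E x y" by blast
  next
    assume "\<exists>x y. e = {x, y} \<and> E x y"
    then obtain x y where xy: "e = {x, y}" "E x y" by blast
    then have "f ` e = {f x, f y}" "E' (f x) (f y)" using E[of x y] that P by auto
    then show "\<exists>x y. f ` e = {x, y} \<and> E' x y" by blast
  qed
  moreover have "disjoint (image f ` P) \<longleftrightarrow> disjoint P"
  proof -
    have "(d \<noteq> e \<longrightarrow> f ` d \<noteq> f ` e \<longrightarrow> disjnt (f ` d) (f ` e)) \<longleftrightarrow> (d \<noteq> e \<longrightarrow> disjnt d e)"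
      if "d \<in> P" "e \<in> P" for d e
    proof -
      have "d \<subseteq> V" "e \<subseteq> V" using that P by blast+
      show ?thesis
        unfolding disjnt_def inj_on_image_eq_iff[OF f \<open>d \<subseteq> V\<close> \<open>e \<subseteq> V\<close>]
          inj_on_image_Int[OF f \<open>d \<subseteq> V\<close> \<open>e \<subseteq> V\<close>, symmetric] image_is_empty by simp
    qed
    then show ?thesis
      by (simp only: pairwise_image) (simp only: pairwise_def cong: ball_cong)
  qed
  moreover have "\<Union>(image f ` P) = f ` V \<longleftrightarrow> \<Union>P = V"
  proof -
    have "\<Union>P \<subseteq> V" using P by blast
    from inj_on_image_eq_iff[OF f this order_refl] show ?thesis by (simp only: image_Union)
  qed
  ultimately show ?thesis by (simp add: perfect_matchings_def)
qed

text \<open>Invariance under graph isomorphism, used to pass from abstract cells to squares of the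
  grid.\<close>

lemma num_matchings_image:
  assumes f: "inj_on f V" and E: "\<And>x y. x \<in> V \<Longrightarrow> y \<in> V \<Longrightarrow> E' (f x) (f y) \<longleftrightarrow> E x y"
  shows "num_matchings E' (f ` V) = num_matchings E V"
proof -
  have bij: "bij_betw (image (image f)) (Pow (Pow V)) (Pow (Pow (f ` V)))"
    by (intro bij_betw_Pow inj_on_imp_bij_betw f)
  have "image (image f) ` perfect_matchings E V = perfect_matchings E' (f ` V)"
  proof
    show "image (image f) ` perfect_matchings E V \<subseteq> perfect_matchings E' (f ` V)"
    proof (rule image_subsetI)
      fix P assume P: "P \<in> perfect_matchings E V"
      then have "P \<subseteq> Pow V" by (auto simp: perfect_matchings_def)
      then show "image f ` P \<in> perfect_matchings E' (f ` V)"
        using perfect_matchings_image_iff[where E = E and E' = E', OF f E] P by blast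
    qed
    show "perfect_matchings E' (f ` V) \<subseteq> image (image f) ` perfect_matchings E V"
    proof
      fix Q assume Q: "Q \<in> perfect_matchings E' (f ` V)"
      then have "Q \<in> Pow (Pow (f ` V))" by (auto simp: perfect_matchings_def)
      then have "Q \<in> image (image f) ` Pow (Pow V)"
        by (simp only: bij_betw_imp_surj_on[OF bij])
      then obtain P where P: "Q = image f ` P" "P \<subseteq> Pow V"
        by (rule imageE) (simp only: Pow_iff)
      then show "Q \<in> image (image f) ` perfect_matchings E V"
        using perfect_matchings_image_iff[where E = E and E' = E', OF f E P(2)] Q P(1) by blast
    qed
  qed
  moreover have "inj_on (image (image f)) (perfect_matchings E V)"
    by (rule inj_on_subset[OF bij_betw_imp_inj_on[OF bij]]) (auto simp: perfect_matchings_def)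
  ultimately show ?thesis by (metis card_image)
qed

section \<open>Grid squares, dominoes and their centres\<close>

definition grid_adj :: "int \<times> int \<Rightarrow> int \<times> int \<Rightarrow> bool" where
  "grid_adj p q \<longleftrightarrow> \<bar>fst p - fst q\<bar> + \<bar>snd p - snd q\<bar> = 1"

definition square :: "int \<times> int \<Rightarrow> (real \<times> real) set" where
  "square p = unit_square (fst p) (snd p)"

text \<open>Centres identify squares: a closed grid square contains no centre but its own, so a
  union of squares can be recovered from the centres in it.\<close>

definition center :: "int \<times> int \<Rightarrow> real \<times> real" where
  "center p = (of_int (fst p) + 1 / 2, of_int (snd p) + 1 / 2)"

lemma center_in_square [simp]: "center p \<in> square q \<longleftrightarrow> p = q"
proof
  assume "center p \<in> square q"
  then have *: "real_of_int (fst q) \<le> fst p + 1 / 2" "fst p + 1 / 2 \<le> real_of_int (fst q + 1)"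
    "real_of_int (snd q) \<le> snd p + 1 / 2" "snd p + 1 / 2 \<le> real_of_int (snd q + 1)"
    by (auto simp: center_def square_def unit_square_def cbox_Pair_eq)
  have "fst p = fst q" using *(1,2) by linarith
  moreover have "snd p = snd q" using *(3,4) by linarith
  ultimately show "p = q" by (rule prod_eqI)
qed (auto simp: center_def square_def unit_square_def cbox_Pair_eq)

lemma center_in_Union_squares [simp]: "center p \<in> \<Union>(square ` S) \<longleftrightarrow> p \<in> S"
  by auto

lemma in_box_real_Pair:
  "(x, y) \<in> box (a, b) (c, d :: real) \<longleftrightarrow> a < x \<and> x < c \<and> b < y \<and> y < (d :: real)"
  for a c :: real
  by (auto simp: mem_box Basis_prod_def)

lemma center_in_interior_square: "center p \<in> interior (square p)"
  by (auto simp: center_def square_def unit_square_def interior_cbox in_box_real_Pair)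

lemma cbox_domino:
  "cbox (real_of_int a, real_of_int b) (real_of_int (a + 2), real_of_int (b + 1)) =
    square (a, b) \<union> square (a + 1, b)"
  "cbox (real_of_int a, real_of_int b) (real_of_int (a + 1), real_of_int (b + 2)) =
    square (a, b) \<union> square (a, b + 1)"
  by (auto simp: square_def unit_square_def cbox_Pair_eq)

lemma domino_iff: "domino K \<longleftrightarrow> (\<exists>p q. grid_adj p q \<and> K = square p \<union> square q)"
proof
  assume "domino K"
  then obtain a b where "K = square (a, b) \<union> square (a + 1, b) \<or> K = square (a, b) \<union> square (a, b + 1)"
    unfolding domino_def cbox_domino by blast
  moreover have "grid_adj (a, b) (a + 1, b)" "grid_adj (a, b) (a, b + 1)"
    by (auto simp: grid_adj_def)
  ultimately show "\<exists>p q. grid_adj p q \<and> K = square p \<union> square q" by blast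
next
  assume "\<exists>p q. grid_adj p q \<and> K = square p \<union> square q"
  then obtain a b c d where adj: "grid_adj (a, b) (c, d)" and K: "K = square (a, b) \<union> square (c, d)"
    by auto
  have "(c, d) = (a + 1, b) \<or> (c, d) = (a, b + 1) \<or> (a, b) = (c + 1, d) \<or> (a, b) = (c, d + 1)"
    using adj unfolding grid_adj_def by (simp add: abs_if split: if_splits) linarith+
  then show "domino K"
    unfolding domino_def cbox_domino K by (metis Un_commute)
qed

lemma domino_int_cbox:
  assumes "domino K"
  shows "\<exists>a b c d :: int. K = cbox (of_int a, of_int b) (of_int c, of_int d)"
  using assms unfolding domino_def by blast

text \<open>Both dominoes are boxes with integral corners. If their interiors meet, the overlap has
  integral corners and sides of length at least 1, so it contains the unit square at its lower left
  corner.\<close>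

lemma dominoes_common_center:
  assumes "domino K" "domino L" "interior K \<inter> interior L \<noteq> {}"
  shows "\<exists>r. center r \<in> K \<and> center r \<in> L"
proof -
  obtain a b c d where K: "K = cbox (real_of_int a, real_of_int b) (real_of_int c, real_of_int d)"
    using domino_int_cbox[OF assms(1)] by blast
  obtain a' b' c' d' where L: "L = cbox (real_of_int a', real_of_int b') (real_of_int c', real_of_int d')"
    using domino_int_cbox[OF assms(2)] by blast
  from assms(3) obtain x y where "(x, y) \<in> interior K" "(x, y) \<in> interior L" by auto
  then have "a < x" "a' < x" "x < c" "x < c'" "b < y" "b' < y" "y < d" "y < d'"
    by (auto simp: K L interior_cbox in_box_real_Pair)
  then have "max a a' < min c c'" "max b b' < min d d'" by linarith+
  then show ?thesis
    by (intro exI[of _ "(max a a', max b b')"]) (auto simp: K L center_def cbox_Pair_eq)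
qed

text \<open>Edges and dominoes correspond under the inverse maps \<open>shape\<close> and
  \<open>cells\<close>. Overlapping interiors yield a common cell, and a common cell yields a common
  interior point, so disjoint edges correspond to non-overlapping dominoes.\<close>

lemma domino_tilings_squares:
  assumes "finite S"
  shows "card (domino_tilings (\<Union>(square ` S))) = num_matchings grid_adj S"
proof -
  define shape where "shape e = \<Union>(square ` e)" for e
  define cells where "cells K = {p. center p \<in> K}" for K
  have cs: "cells (shape e) = e" for e
    by (simp only: cells_def shape_def center_in_Union_squares Collect_mem_eq)
  have inj: "inj shape" by (metis cs injI)
  have dom: "domino (shape e)" if "e = {x, y}" "grid_adj x y" for e x y
  proof -
    have "shape e = square x \<union> square y" using that(1) by (simp add: shape_def)
    then show ?thesis unfolding domino_iff using that(2) by blast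
  qed
  have sc: "shape (cells K) = K" "\<exists>x y. cells K = {x, y} \<and> grid_adj x y" if "domino K" for K
  proof -
    obtain p q where "grid_adj p q" "K = shape {p, q}"
      using \<open>domino K\<close> unfolding shape_def domino_iff by auto
    then show "shape (cells K) = K" "\<exists>x y. cells K = {x, y} \<and> grid_adj x y"
      unfolding \<open>K = _\<close> cs by blast+
  qed
  have "image shape ` perfect_matchings grid_adj S = domino_tilings (\<Union>(square ` S))"
  proof
    show "image shape ` perfect_matchings grid_adj S \<subseteq> domino_tilings (\<Union>(square ` S))"
    proof (rule image_subsetI)
      fix P assume P: "P \<in> perfect_matchings grid_adj S"
      have d: "domino (shape e)" if "e \<in> P" for e
        using P that dom by (auto simp: perfect_matchings_def)
      have US: "\<Union>P = S" using P by (simp add: perfect_matchings_def)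
      have "shape ` P division_of \<Union>(square ` S)"
      proof (rule division_ofI)
        have "finite P" using US assms finite_UnionD by blast
        then show "finite (shape ` P)" by simp
        show "\<Union>(shape ` P) = \<Union>(square ` S)" unfolding shape_def US[symmetric] by blast
        then show "K \<subseteq> \<Union>(square ` S)" if "K \<in> shape ` P" for K using that by blast
        show "K \<noteq> {}" if K: "K \<in> shape ` P" for K
        proof -
          obtain e where e: "e \<in> P" "K = shape e" using K by blast
          then have "e \<noteq> {}" using P by (auto simp: perfect_matchings_def)
          then show ?thesis using cs[of e] e by (auto simp: cells_def)
        qed
        show "\<exists>a b. K = cbox a b" if "K \<in> shape ` P" for K
          using that d domino_int_cbox by blast
        show "interior K \<inter> interior L = {}" if "K \<in> shape ` P" "L \<in> shape ` P" "K \<noteq> L" for K L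
        proof (rule ccontr)
          obtain e f where ef: "e \<in> P" "f \<in> P" "K = shape e" "L = shape f" using \<open>K \<in> _\<close> \<open>L \<in> _\<close> by blast
          assume "interior K \<inter> interior L \<noteq> {}"
          then obtain r where "r \<in> cells K" "r \<in> cells L"
            using dominoes_common_center d ef unfolding cells_def by blast
          then have "r \<in> e \<inter> f" by (simp add: ef cs)
          then have "e = f" using P ef by (auto simp: perfect_matchings_def pairwise_def disjnt_def)
          then show False using ef \<open>K \<noteq> L\<close> by simp
        qed
      qed
      then show "shape ` P \<in> domino_tilings (\<Union>(square ` S))"
        using d by (auto simp: domino_tilings_def)
    qed
    show "domino_tilings (\<Union>(square ` S)) \<subseteq> image shape ` perfect_matchings grid_adj S"
    proof
      fix T assume "T \<in> domino_tilings (\<Union>(square ` S))"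
      then have T: "T division_of \<Union>(square ` S)" and d: "\<And>K. K \<in> T \<Longrightarrow> domino K"
        by (auto simp: domino_tilings_def)
      have "disjoint (cells ` T)"
      proof (rule pairwiseI)
        fix e f assume "e \<in> cells ` T" "f \<in> cells ` T" "e \<noteq> f"
        then obtain K L where KL: "K \<in> T" "L \<in> T" "K \<noteq> L" "e = cells K" "f = cells L" by blast
        have "e \<inter> f = {}"
        proof (rule ccontr)
          assume "e \<inter> f \<noteq> {}"
          then obtain r where "r \<in> cells K" "r \<in> cells L" using KL by blast
          then have "square r \<subseteq> shape (cells K)" "square r \<subseteq> shape (cells L)"
            by (auto simp: shape_def)
          then have "square r \<subseteq> K" "square r \<subseteq> L" using sc(1) d KL by auto
          then have "center r \<in> interior K \<inter> interior L"
            using center_in_interior_square[of r] interior_mono by blast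
          then show False using division_ofD(5)[OF T KL(1-3)] by blast
        qed
        then show "disjnt e f" by (simp add: disjnt_def)
      qed
      \<comment> \<open>Coverage is tested at centres: \<open>p\<close> lies in some
        \<open>cells K\<close> iff its centre lies in the tiled region, that is, iff
        \<open>p\<close> is in \<open>S\<close>.\<close>
      moreover have "\<Union>(cells ` T) = S"
      proof -
        have "p \<in> \<Union>(cells ` T) \<longleftrightarrow> center p \<in> \<Union>T" for p by (simp add: cells_def)
        then show ?thesis using division_ofD(6)[OF T] by (auto simp del: Union_iff UN_iff)
      qed
      ultimately have "cells ` T \<in> perfect_matchings grid_adj S"
        using sc(2) d by (auto simp: perfect_matchings_def)
      moreover have "T = shape ` cells ` T"
        using sc(1) d by (simp add: image_image)
      ultimately show "T \<in> image shape ` perfect_matchings grid_adj S" by blast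
    qed
  qed
  moreover have "inj_on (image shape) (perfect_matchings grid_adj S)"
    using inj by (simp add: inj_image_eq_iff inj_on_def)
  ultimately show ?thesis by (metis card_image)
qed

section \<open>Position of the cells in the plane\<close>

text \<open>Along the rows \<open>a + b\<close> is constant, and \<open>a - b\<close> grows by 2 from each cell to the next.\<close>

fun cell_pos :: "nat \<Rightarrow> cell \<Rightarrow> int \<times> int" where
  "cell_pos n (ACell i j) = (int i + int j - int n, int i - int j - 1)"
| "cell_pos n (BCell i j) = (int i + int j - int n, int i - int j)"

text \<open>The parity of a + b + n separates A-cells from B-cells; within each kind, a + b
  determines \<open>i\<close> and a - b determines \<open>j\<close>.\<close>

lemma inj_cell_pos: "inj (cell_pos n)"
proof (rule injI)
  show "x = y" if "cell_pos n x = cell_pos n y" for x y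
    using that by (cases x; cases y) (auto, presburger+)
qed

text \<open>Two squares share a side iff both a + b and a - b change by 1 or -1. Between cells of
  the same kind these changes are even, and between an A-cell and a B-cell they give exactly the
  condition in \<open>adj\<close>.\<close>

lemma grid_adj_cell_pos: "grid_adj (cell_pos n x) (cell_pos n y) \<longleftrightarrow> adj x y"
proof (cases x; cases y)
  show ?thesis if "x = ACell i j" "y = ACell k l" for i j k l
    unfolding that grid_adj_def by simp presburger
  show ?thesis if "x = BCell i j" "y = BCell k l" for i j k l
    unfolding that grid_adj_def by simp presburger
  show ?thesis if "x = ACell i j" "y = BCell k l" for i j k l
    unfolding that grid_adj_def by simp presburger
  show ?thesis if "x = BCell i j" "y = ACell k l" for i j k l
    unfolding that grid_adj_def by simp presburger
qed

lemma cell_pos_image: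
  "cell_pos n ` (aztec_rows n n \<union> ACell n ` {..<n}) =
    {(a, b). \<bar>a + b + 1\<bar> \<le> int n \<and> \<bar>a - b\<bar> \<le> int n}"
proof
  show "cell_pos n ` (aztec_rows n n \<union> ACell n ` {..<n}) \<subseteq>
      {(a, b). \<bar>a + b + 1\<bar> \<le> int n \<and> \<bar>a - b\<bar> \<le> int n}"
  proof (rule image_subsetI)
    show "cell_pos n x \<in> {(a, b). \<bar>a + b + 1\<bar> \<le> int n \<and> \<bar>a - b\<bar> \<le> int n}"
      if "x \<in> aztec_rows n n \<union> ACell n ` {..<n}" for x
      using that by (cases x) auto
  qed
  show "{(a, b). \<bar>a + b + 1\<bar> \<le> int n \<and> \<bar>a - b\<bar> \<le> int n} \<subseteq>
      cell_pos n ` (aztec_rows n n \<union> ACell n ` {..<n})"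
  proof (rule subsetI)
    fix p assume "p \<in> {(a, b). \<bar>a + b + 1\<bar> \<le> int n \<and> \<bar>a - b\<bar> \<le> int n}"
    then obtain a b where p: "p = (a, b)" and ab: "\<bar>a + b + 1\<bar> \<le> int n" "\<bar>a - b\<bar> \<le> int n" by auto
    show "p \<in> cell_pos n ` (aztec_rows n n \<union> ACell n ` {..<n})"
    \<comment> \<open>For A-cells a + b + 1 + n is 2 i, for B-cells it is 2 i + 1. The index
      \<open>j\<close> is then read off from a = i + j - n.\<close>
    proof (cases "even (a + b + 1 + int n)")
      case True
      then obtain i where i: "a + b + 1 + int n = 2 * i" by blast
      define j where "j = a + int n - i"
      have "p = cell_pos n (ACell (nat i) (nat j))" and "nat i \<le> n" "nat j < n"
        using i ab by (auto simp: p j_def)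
      moreover from this(2,3) have "ACell (nat i) (nat j) \<in> aztec_rows n n \<union> ACell n ` {..<n}"
        by (cases "nat i = n") simp_all
      ultimately show ?thesis by (intro image_eqI)
    next
      case False
      then have "even (a + b + int n)" by presburger
      then obtain i where i: "a + b + int n = 2 * i" by blast
      define j where "j = a + int n - i"
      have "p = cell_pos n (BCell (nat i) (nat j))" and "nat i < n" "nat j \<le> n"
        using i ab by (auto simp: p j_def)
      moreover from this(2,3) have "BCell (nat i) (nat j) \<in> aztec_rows n n \<union> ACell n ` {..<n}"
        by simp
      ultimately show ?thesis by (intro image_eqI)
    qed
  qed
qed

text \<open>As |x| + |y| is the largest of the four sums of x or -x with y or -y, each corner
  supplies one of the four linear bounds on a + b + 1 and a - b.\<close>

lemma aztec_diamond_squares: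
  "aztec_diamond n = \<Union>(square ` {(a, b). \<bar>a + b + 1\<bar> \<le> int n \<and> \<bar>a - b\<bar> \<le> int n})"
proof -
  have "(\<forall>x\<in>{a, a + 1}. \<forall>y\<in>{b, b + 1}. \<bar>x\<bar> + \<bar>y\<bar> \<le> int n + 1) \<longleftrightarrow>
      \<bar>a + b + 1\<bar> \<le> int n \<and> \<bar>a - b\<bar> \<le> int n" for a b :: int
    by (simp add: abs_if) linarith
  then show ?thesis
    unfolding aztec_diamond_def square_def by (auto simp: image_def)
qed

theorem card_aztec_tilings:
  "int (card (domino_tilings (aztec_diamond n))) = 2 ^ (n * (n + 1) div 2)"
proof -
  let ?V = "aztec_rows n n \<union> ACell n ` {..<n}"
  have "aztec_diamond n = \<Union>(square ` cell_pos n ` ?V)"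
    unfolding aztec_diamond_squares cell_pos_image ..
  then have "card (domino_tilings (aztec_diamond n)) = num_matchings grid_adj (cell_pos n ` ?V)"
    by (simp only: domino_tilings_squares finite_imageI finite_UnI finite_aztec_rows finite_lessThan)
  also have "\<dots> = num_matchings adj ?V"
    by (rule num_matchings_image) (auto intro: inj_on_subset[OF inj_cell_pos] simp: grid_adj_cell_pos)
  finally show ?thesis by (simp only: num_matchings_aztec)
qed

section \<open>Schroeder numbers\<close>

text \<open>The sequence 1, 1, 3, 11, 45, ...; the recursion is the coefficient form of f = 1 + x f
  (2 f - 1).\<close>

fun little_schroeder :: "nat \<Rightarrow> int" where
  "little_schroeder 0 = 1"
| "little_schroeder (Suc n) =
    2 * (\<Sum>i\<le>n. little_schroeder i * little_schroeder (n - i)) - little_schroeder n"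

definition little_schroeder_fps :: "int fps" where
  "little_schroeder_fps = Abs_fps little_schroeder"

definition large_schroeder_fps :: "int fps" where
  "large_schroeder_fps = 2 * little_schroeder_fps - 1"

lemma little_schroeder_fps_eq:
  "little_schroeder_fps = 1 + fps_X * little_schroeder_fps * large_schroeder_fps"
proof (rule fps_ext)
  fix n
  have "little_schroeder_fps * large_schroeder_fps =
      fps_const 2 * (little_schroeder_fps * little_schroeder_fps) - little_schroeder_fps"
    by (simp add: large_schroeder_fps_def algebra_simps numeral_fps_const)
  then have "(little_schroeder_fps * large_schroeder_fps) $ j = little_schroeder (Suc j)" for j
    by (simp add: fps_mult_nth[of "Abs_fps little_schroeder" "Abs_fps little_schroeder"]
        little_schroeder_fps_def atLeast0AtMost)
  then show "little_schroeder_fps $ n =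
      (1 + fps_X * little_schroeder_fps * large_schroeder_fps) $ n"
    by (cases n) (simp_all add: mult.assoc little_schroeder_fps_def del: little_schroeder.simps(2))
qed

lemma large_schroeder_fps_eq:
  "large_schroeder_fps = 1 + fps_X * large_schroeder_fps + fps_X * large_schroeder_fps ^ 2"
proof -
  have "large_schroeder_fps = 2 * (1 + fps_X * little_schroeder_fps * large_schroeder_fps) - 1"
    using little_schroeder_fps_eq by (simp add: large_schroeder_fps_def)
  also have "\<dots> = 1 + fps_X * (2 * little_schroeder_fps) * large_schroeder_fps"
    by (simp add: algebra_simps)
  also have "2 * little_schroeder_fps = large_schroeder_fps + 1"
    by (simp add: large_schroeder_fps_def)
  finally show ?thesis by (simp add: algebra_simps power2_eq_square)
qed

section \<open>Counting paths that start below the diagonal\<close>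

text \<open>These paths run from (k, 0) to (m, m). The free starting point makes the family closed
  under removal of the first step.\<close>

definition paths_from_height :: "nat \<Rightarrow> nat \<Rightarrow> (nat \<times> nat) list set" where
  "paths_from_height k m =
     {p. set p \<subseteq> {(0, 1), (1, 0), (1, 1)} \<and> sum_list p + (k, 0) = (m, m) \<and>
         (\<forall>t \<le> length p. snd (sum_list (take t p)) \<le> fst (sum_list (take t p)) + k)}"

lemma schroeder_paths_eq: "schroeder_paths m = paths_from_height 0 m"
  by (simp add: schroeder_paths_def paths_from_height_def zero_prod_def[symmetric])

lemma all_le_Suc_iff: "(\<forall>t \<le> Suc l. Q t) \<longleftrightarrow> Q 0 \<and> (\<forall>t \<le> l. Q (Suc t))"
  by (metis Suc_le_mono not0_implies_Suc zero_le)

lemma Nil_in_paths_from_height: "[] \<in> paths_from_height k m \<longleftrightarrow> k = 0 \<and> m = 0"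
  by (auto simp: paths_from_height_def)

text \<open>After a vertical or a diagonal first step the remaining path is translated by (-1, -1),
  which puts its start back on the x-axis and lowers \<open>m\<close> by 1.\<close>

lemma Cons_in_paths_from_height:
  "s # p \<in> paths_from_height k m \<longleftrightarrow>
    s = (0, 1) \<and> 0 < k \<and> 0 < m \<and> p \<in> paths_from_height (k - 1) (m - 1) \<or>
    s = (1, 0) \<and> p \<in> paths_from_height (Suc k) m \<or>
    s = (1, 1) \<and> 0 < m \<and> p \<in> paths_from_height k (m - 1)"
proof (cases "s \<in> {(0, 1), (1, 0), (1, 1)}")
  case True
  then show ?thesis
    by (cases k; cases m)
      (auto simp: paths_from_height_def all_le_Suc_iff prod_eq_iff)
next
  case False
  then show ?thesis by (auto simp: paths_from_height_def)
qed

lemma paths_from_height_eq: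
  "paths_from_height k m =
    (if k = 0 \<and> m = 0 then {[]} else {}) \<union>
    (Cons (0, 1) ` (if 0 < k \<and> 0 < m then paths_from_height (k - 1) (m - 1) else {}) \<union>
    (Cons (1, 0) ` paths_from_height (Suc k) m \<union>
     Cons (1, 1) ` (if 0 < m then paths_from_height k (m - 1) else {})))"
  (is "_ = ?rhs")
proof (rule Set.set_eqI)
  show "p \<in> paths_from_height k m \<longleftrightarrow> p \<in> ?rhs" for p
    by (cases p) (auto simp: Nil_in_paths_from_height Cons_in_paths_from_height)
qed

text \<open>The power series reflects a decomposition into k + 1 Schroeder paths separated by the k
  vertical steps that first come closer to the diagonal than before. It is verified through the
  first-step recurrence.\<close>

lemma card_paths_from_height:
  "finite (paths_from_height k m) \<and>
    int (card (paths_from_height k m)) = (fps_X ^ k * large_schroeder_fps ^ Suc k) $ m"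
\<comment> \<open>A horizontal step raises \<open>k\<close>, a vertical one lowers both
  \<open>k\<close> and \<open>m\<close>, a diagonal one lowers \<open>m\<close>. This measure
  decreases in all three cases as long as \<open>k \<le> m\<close>; for larger \<open>k\<close> both
  sides vanish.\<close>
proof (induction "2 * m + 1 - k" arbitrary: k m rule: less_induct)
  case less
  let ?G = "\<lambda>k. fps_X ^ k * large_schroeder_fps ^ Suc k"
  let ?D = "if 0 < k \<and> 0 < m then paths_from_height (k - 1) (m - 1) else {}"
  let ?H = "if 0 < m then paths_from_height k (m - 1) else {}"
  show ?case
  proof (cases "k \<le> m")
    case False
    then have "paths_from_height k m = {}" by (auto simp: paths_from_height_def prod_eq_iff)
    then show ?thesis using False by (simp add: fps_X_power_mult_nth)
  next
    case True
    have D: "finite ?D \<and> int (card ?D) = (if k = 0 then 0 else (fps_X * ?G (k - 1)) $ m)"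
      using less[of "m - 1" "k - 1"] True by (cases k; cases m) auto
    have H: "finite ?H \<and> int (card ?H) = (fps_X * ?G k) $ m"
      using less[of "m - 1" k] True by (cases m) auto
    have U: "finite (paths_from_height (Suc k) m) \<and> int (card (paths_from_height (Suc k) m)) = ?G (Suc k) $ m"
      using less[of m "Suc k"] True by auto
    have fin: "finite (paths_from_height k m)"
      by (subst paths_from_height_eq) (use D H U in auto)
    let ?N = "if k = 0 \<and> m = 0 then {[]} else {} :: (nat \<times> nat) list set"
    let ?X = "Cons (0, 1) ` ?D" and ?Y = "Cons (1, 0) ` paths_from_height (Suc k) m"
      and ?Z = "Cons (1, 1) ` ?H"
    have fins: "finite ?N" "finite ?X" "finite ?Y" "finite ?Z" using D H U by auto
    have disj: "?Y \<inter> ?Z = {}" "?X \<inter> (?Y \<union> ?Z) = {}" "?N \<inter> (?X \<union> (?Y \<union> ?Z)) = {}"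
      by auto
    have card_Cons: "card (Cons s ` A) = card A" for s :: "nat \<times> nat" and A
      by (rule card_image) (simp add: inj_on_def)
    have "card (paths_from_height k m) = card ?N + (card ?D + (card (paths_from_height (Suc k) m) + card ?H))"
      by (subst paths_from_height_eq)
        (simp only: card_Un_disjoint fins finite_UnI disj card_Cons)
    then have "int (card (paths_from_height k m)) =
        int (card ?N) + (int (card ?D) + (int (card (paths_from_height (Suc k) m)) + int (card ?H)))"
      by (simp only: of_nat_add)
    also have "\<dots> = (if k = 0 \<and> m = 0 then 1 else 0) +
        ((if k = 0 then 0 else (fps_X * ?G (k - 1)) $ m) + (?G (Suc k) $ m + (fps_X * ?G k) $ m))"
      using D H U by (simp only:) simp
    \<comment> \<open>The recurrence is r = 1 + x r + x r^2 multiplied by x^k r^k. For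
      \<open>k = 0\<close> the term 1 is the empty path, otherwise it becomes the contribution of a
      vertical step.\<close>
    also have "\<dots> = ?G k $ m"
    proof (cases k)
      case 0
      have "?G 0 $ m = (1 + fps_X * ?G 0 + ?G (Suc 0)) $ m"
        using arg_cong[OF large_schroeder_fps_eq, of "\<lambda>h. h $ m"]
        by (simp add: power2_eq_square)
      then show ?thesis by (simp add: 0)
    next
      case (Suc l)
      have "?G (Suc l) = fps_X ^ Suc l * large_schroeder_fps ^ Suc l * large_schroeder_fps"
        by (simp add: mult_ac)
      also have "\<dots> = fps_X ^ Suc l * large_schroeder_fps ^ Suc l *
          (1 + fps_X * large_schroeder_fps + fps_X * large_schroeder_fps ^ 2)"
        by (simp only: large_schroeder_fps_eq[symmetric])
      also have "\<dots> = fps_X * ?G l + fps_X * ?G (Suc l) + ?G (Suc (Suc l))"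
        by (simp add: algebra_simps power2_eq_square)
      finally have "?G (Suc l) = fps_X * ?G l + fps_X * ?G (Suc l) + ?G (Suc (Suc l))" .
      then have "?G (Suc l) $ m = (fps_X * ?G l + fps_X * ?G (Suc l) + ?G (Suc (Suc l))) $ m"
        by (rule arg_cong)
      also have "\<dots> =
          (fps_X * ?G l) $ m + (fps_X * ?G (Suc l)) $ m + ?G (Suc (Suc l)) $ m"
        by (simp only: fps_add_nth)
      finally show ?thesis by (simp only: Suc diff_Suc_1 nat.distinct simp_thms if_False add_0 add_ac)
    qed
    finally show ?thesis using fin by simp
  qed
qed

lemma large_schroeder_eq: "int (large_schroeder m) = large_schroeder_fps $ m"
  using card_paths_from_height[of 0 m] by (simp add: large_schroeder_def schroeder_paths_eq)

section \<open>The determinant\<close>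

text \<open>In \<^typ>\<open>int fps fps\<close> the inner variable \<open>x\<close> is \<^term>\<open>fps_const fps_X\<close>, the outer variable
  \<open>y\<close> is \<^term>\<open>fps_X\<close>, and \<open>outer_fps h\<close> is \<open>h(y)\<close>.\<close>

definition outer_fps :: "int fps \<Rightarrow> int fps fps" where
  "outer_fps h = Abs_fps (\<lambda>k. fps_const (h $ k))"

lemma outer_fps_nth [simp]: "outer_fps h $ k = fps_const (h $ k)"
  by (simp add: outer_fps_def)

lemma fps_const_sum: "fps_const (sum f A) = (\<Sum>a\<in>A. fps_const (f a))"
  by (induction A rule: infinite_finite_induct) (simp_all flip: fps_const_add)

lemma outer_fps_simps [simp]:
  "outer_fps 1 = 1" "outer_fps fps_X = fps_X" "outer_fps (g + h) = outer_fps g + outer_fps h"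
  "outer_fps (g - h) = outer_fps g - outer_fps h" "outer_fps (g * h) = outer_fps g * outer_fps h"
  by (rule fps_ext; simp add: fps_mult_nth fps_const_sum del: fps_mult_nth_0)+

lemma outer_fps_power [simp]: "outer_fps (h ^ k) = outer_fps h ^ k"
  by (induction k) simp_all

section \<open>The Gram matrix of the Schroeder rows and its generating function\<close>

text \<open>The entries of I + S S^T with rows and columns counted from the last one, which makes
  them independent of \<open>n\<close>.\<close>

definition schroeder_gram :: "nat \<Rightarrow> nat \<Rightarrow> int" where
  "schroeder_gram p q =
     (\<Sum>k\<le>min p q. large_schroeder_fps $ (p - k) * large_schroeder_fps $ (q - k)) + of_bool (p = q)"

text \<open>Column \<open>k\<close> of the Riordan array of (f, x f); these columns form the
  unitriangular factor.\<close>

definition schroeder_factor :: "nat \<Rightarrow> int fps" where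
  "schroeder_factor k = fps_X ^ k * little_schroeder_fps ^ Suc k"

lemma schroeder_gram_Suc:
  "schroeder_gram (Suc p) (Suc q) =
    schroeder_gram p q + large_schroeder_fps $ Suc p * large_schroeder_fps $ Suc q"
  by (simp add: schroeder_gram_def sum.atMost_Suc_shift del: sum.atMost_Suc)

definition schroeder_gram_fps :: "int fps fps" where
  "schroeder_gram_fps = Abs_fps (\<lambda>q. Abs_fps (\<lambda>p. schroeder_gram p q))"

text \<open>Multiplication by 1 - x y takes differences along diagonals. By
  \<open>schroeder_gram_Suc\<close> the Gram sums telescope to r(x) r(y), and the identity matrix
  leaves 1.\<close>

lemma schroeder_gram_fps_mult:
  "(1 - fps_const fps_X * fps_X) * schroeder_gram_fps =
    fps_const large_schroeder_fps * outer_fps large_schroeder_fps + 1"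
proof -
  have "schroeder_gram_fps = fps_const large_schroeder_fps * outer_fps large_schroeder_fps + 1 +
      fps_X * (fps_const fps_X * schroeder_gram_fps)"
  proof (rule fps_ext, rule fps_ext)
    fix q p
    show "schroeder_gram_fps $ q $ p = (fps_const large_schroeder_fps * outer_fps large_schroeder_fps + 1 +
      fps_X * (fps_const fps_X * schroeder_gram_fps)) $ q $ p"
      by (cases p; cases q)
        (simp_all add: schroeder_gram_fps_def schroeder_gram_Suc schroeder_gram_def[of 0]
          schroeder_gram_def[of _ 0] del: fps_mult_nth_0)
  qed
  then show ?thesis by (simp add: algebra_simps)
qed

text \<open>Here f = f(x), g = f(y), and A is the kernel (r(x) r(y) + 1) / (1 - x y). After
  multiplication by 1 - x y the equations for f and g reduce the claim to (2 f - 1)(2 g - 1) + 1 - 2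
  f g = 2 (f - 1)(g - 1).\<close>

lemma kernel_fixpoint:
  fixes x y f g A :: "'a :: idom"
  assumes f: "x * f * (2 * f - 1) = f - 1" and g: "y * g * (2 * g - 1) = g - 1"
    and A: "(1 - x * y) * A = (2 * f - 1) * (2 * g - 1) + 1" and "1 - x * y \<noteq> 0"
  shows "A = 2 * f * g + 2 * (x * y) * (f * g) * A"
proof -
  have "(1 - x * y) * (A - (2 * f * g + 2 * (x * y) * (f * g) * A)) =
      ((1 - x * y) * A) * (1 - 2 * x * y * f * g) - 2 * f * g * (1 - x * y)"
    by (simp add: algebra_simps)
  also have "\<dots> = (2 * f - 1) * (2 * g - 1) + 1 - 2 * f * g -
      2 * (x * f * (2 * f - 1)) * (y * g * (2 * g - 1))"
    unfolding A by (simp add: algebra_simps)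
  also have "\<dots> = 0"
    unfolding f g by (simp add: algebra_simps)
  finally have "A - (2 * f * g + 2 * (x * y) * (f * g) * A) = 0"
    using assms(4) by (simp only: mult_eq_0_iff simp_thms)
  then show ?thesis by (simp only: right_minus_eq)
qed

lemma schroeder_gram_fps_fixpoint:
  defines "u \<equiv> fps_const little_schroeder_fps * outer_fps little_schroeder_fps"
  shows "schroeder_gram_fps = 2 * u + 2 * (fps_const fps_X * fps_X) * u * schroeder_gram_fps"
proof -
  let ?x = "fps_const fps_X :: int fps fps" and ?y = "fps_X :: int fps fps"
  define f g where "f = fps_const little_schroeder_fps" and "g = outer_fps little_schroeder_fps"
  have r: "fps_const large_schroeder_fps = 2 * f - 1"
    by (simp only: f_def large_schroeder_fps_def mult_2 fps_const_add fps_const_sub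
        fps_const_1_eq_1[where 'a = "int fps", symmetric])
  have r': "outer_fps large_schroeder_fps = 2 * g - 1"
    by (simp only: g_def large_schroeder_fps_def mult_2 outer_fps_simps)
  have "f = fps_const (1 + fps_X * little_schroeder_fps * large_schroeder_fps)"
    unfolding f_def by (rule arg_cong[OF little_schroeder_fps_eq])
  also have "\<dots> = 1 + ?x * f * (2 * f - 1)"
    unfolding r[symmetric] unfolding f_def
    by (simp only: fps_const_add fps_const_mult fps_const_1_eq_1[where 'a = "int fps", symmetric])
  finally have "f - 1 = 1 + ?x * f * (2 * f - 1) - 1" by (rule arg_cong)
  then have f: "?x * f * (2 * f - 1) = f - 1" by (simp only: add_diff_cancel_left')
  have "g = outer_fps (1 + fps_X * little_schroeder_fps * large_schroeder_fps)"
    unfolding g_def by (rule arg_cong[OF little_schroeder_fps_eq])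
  also have "\<dots> = 1 + ?y * g * (2 * g - 1)"
    unfolding r'[symmetric] unfolding g_def by (simp only: outer_fps_simps)
  finally have "g - 1 = 1 + ?y * g * (2 * g - 1) - 1" by (rule arg_cong)
  then have g: "?y * g * (2 * g - 1) = g - 1" by (simp only: add_diff_cancel_left')
  let ?A = schroeder_gram_fps
  have A: "(1 - ?x * ?y) * ?A = (2 * f - 1) * (2 * g - 1) + 1"
    using schroeder_gram_fps_mult unfolding r r' .
  have "1 - ?x * ?y \<noteq> 0"
  proof
    assume "1 - ?x * ?y = 0"
    then have "(1 - ?x * ?y) $ 0 = 0" by simp
    then show False by simp
  qed
  then have "?A = 2 * f * g + 2 * (?x * ?y) * (f * g) * ?A"
    by (rule kernel_fixpoint[OF f g A])
  then show ?thesis by (simp only: u_def f_def[symmetric] g_def[symmetric] mult.assoc)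
qed

text \<open>Iterating the fixpoint equation \<open>m\<close> times gives a finite geometric sum,
  whose \<open>k\<close>-th term 2^(k+1) (x y)^k (f(x) f(y))^(k+1) separates the two
  variables.\<close>

lemma schroeder_gram_expansion:
  assumes "q < m"
  shows "schroeder_gram p q = (\<Sum>k<m. 2 ^ Suc k * (schroeder_factor k $ p * schroeder_factor k $ q))"
proof -
  define u where "u = fps_const little_schroeder_fps * outer_fps little_schroeder_fps"
  define w where "w = 2 * (fps_const fps_X * fps_X) * u"
  have fixpoint: "schroeder_gram_fps = 2 * u + w * schroeder_gram_fps"
    unfolding w_def u_def by (rule schroeder_gram_fps_fixpoint)
  have expand: "schroeder_gram_fps = (\<Sum>k<m. 2 * u * w ^ k) + w ^ m * schroeder_gram_fps" for m
  proof (induction m)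
    case (Suc m)
    have "w ^ m * schroeder_gram_fps = w ^ m * (2 * u + w * schroeder_gram_fps)"
      using fixpoint by simp
    with Suc show ?case by (simp add: algebra_simps)
  qed simp
  have coeff: "(2 * u * w ^ k) $ q $ p = 2 ^ Suc k * (schroeder_factor k $ p * schroeder_factor k $ q)" for k
  proof -
    have "2 * u * w ^ k = fps_const (fps_const (2 ^ Suc k)) *
        (fps_const (schroeder_factor k) * outer_fps (schroeder_factor k))"
      by (simp add: w_def u_def schroeder_factor_def power_mult_distrib mult_ac numeral_fps_const
          flip: fps_const_mult fps_const_power)
    then show ?thesis by simp
  qed
  \<comment> \<open>The remainder is divisible by y^m and so does not reach the coefficient of y^q
    with \<open>q < m\<close>.\<close>
  have "w ^ m = fps_X ^ m * (2 * fps_const fps_X * u) ^ m"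
    by (simp add: w_def power_mult_distrib mult_ac)
  then have "(w ^ m * schroeder_gram_fps) $ q = 0"
    using assms by (simp add: mult.assoc fps_X_power_mult_nth)
  then have "schroeder_gram_fps $ q = (\<Sum>k<m. (2 * u * w ^ k) $ q)"
    using arg_cong[OF expand[of m], of "\<lambda>h. h $ q"] by (simp add: fps_sum_nth)
  then have "schroeder_gram_fps $ q $ p = (\<Sum>k<m. (2 * u * w ^ k) $ q $ p)"
    by (simp add: fps_sum_nth)
  then show ?thesis unfolding coeff by (simp add: schroeder_gram_fps_def)
qed

lemma schroeder_factor_nth:
  "p < k \<Longrightarrow> schroeder_factor k $ p = 0" "schroeder_factor k $ k = 1"
  by (simp_all add: schroeder_factor_def fps_X_power_mult_nth fps_power_zeroth little_schroeder_fps_def)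

section \<open>Evaluation of the block determinant\<close>

lemma det_schroeder:
  "det (four_block_mat (schroeder_mat n) (1\<^sub>m n) (- 1\<^sub>m n) (transpose_mat (schroeder_mat n))) =
    2 ^ (n * (n + 1) div 2)"
proof -
  let ?S = "schroeder_mat n"
  \<comment> \<open>Reversing the indices makes the factor upper unitriangular. \<open>V\<close> is
    \<open>U\<close> with column \<open>k\<close> scaled by 2^(n-k), so the diagonal matrix is
    absorbed into it.\<close>
  define U where "U = mat n n (\<lambda>(p, k). schroeder_factor (n - 1 - k) $ (n - 1 - p))"
  define V where "V = mat n n (\<lambda>(p, k). 2 ^ (n - k) * schroeder_factor (n - 1 - k) $ (n - 1 - p))"
  have S: "?S \<in> carrier_mat n n" by (simp add: schroeder_mat_def)
  \<comment> \<open>The block formula applies because the lower blocks commute, one of them being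
    minus the identity. The result is det (S S^T + I).\<close>
  have "det (four_block_mat ?S (1\<^sub>m n) (- 1\<^sub>m n) (transpose_mat ?S)) =
      det (?S * transpose_mat ?S - 1\<^sub>m n * (- 1\<^sub>m n))"
    by (rule det_four_block_mat[of _ n]) (use S in auto)
  also have "?S * transpose_mat ?S - 1\<^sub>m n * (- 1\<^sub>m n) = V * transpose_mat U"
  proof (rule eq_matI)
    fix p q assume "p < dim_row (V * transpose_mat U)" "q < dim_col (V * transpose_mat U)"
    then have pq: "p < n" "q < n" by (simp_all add: U_def V_def)
    have "(?S * transpose_mat ?S - 1\<^sub>m n * (- 1\<^sub>m n)) $$ (p, q) =
        (\<Sum>k<n. (if p \<le> k then large_schroeder_fps $ (k - p) else 0) *
          (if q \<le> k then large_schroeder_fps $ (k - q) else 0)) + of_bool (p = q)"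
      using pq by (auto simp: schroeder_mat_def scalar_prod_def lessThan_atLeast0 large_schroeder_eq
          intro!: sum.cong)
    also have "(\<Sum>k<n. (if p \<le> k then large_schroeder_fps $ (k - p) else 0) *
          (if q \<le> k then large_schroeder_fps $ (k - q) else 0)) =
        (\<Sum>k\<in>{max p q..<n}. large_schroeder_fps $ (k - p) * large_schroeder_fps $ (k - q))"
      by (rule sum.mono_neutral_cong_right) auto
    also have "\<dots> = (\<Sum>k\<le>min (n - 1 - p) (n - 1 - q).
        large_schroeder_fps $ (n - 1 - p - k) * large_schroeder_fps $ (n - 1 - q - k))"
      by (rule sum.reindex_bij_witness[of _ "\<lambda>k. n - 1 - k" "\<lambda>k. n - 1 - k"])
        (use pq in \<open>auto intro!: arg_cong2[of _ _ _ _ "\<lambda>i j. large_schroeder_fps $ i * large_schroeder_fps $ j"]\<close>)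
    also have "\<dots> + of_bool (p = q) = schroeder_gram (n - 1 - p) (n - 1 - q)"
      using pq by (auto simp: schroeder_gram_def)
    also have "\<dots> = (\<Sum>k<n. 2 ^ Suc k *
        (schroeder_factor k $ (n - 1 - p) * schroeder_factor k $ (n - 1 - q)))"
      by (rule schroeder_gram_expansion) (use pq in auto)
    \<comment> \<open>Replacing \<open>k\<close> by \<open>n - 1 - k\<close> matches the reversed
      columns of \<open>U\<close> and \<open>V\<close> and turns the exponent \<open>Suc k\<close>
      into \<open>n - k\<close>.\<close>
    also have "\<dots> = (\<Sum>k<n. 2 ^ (n - k) *
        (schroeder_factor (n - 1 - k) $ (n - 1 - p) * schroeder_factor (n - 1 - k) $ (n - 1 - q)))"
      by (rule sum.reindex_bij_witness[of _ "\<lambda>k. n - 1 - k" "\<lambda>k. n - 1 - k"])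
        (auto simp: Suc_diff_Suc)
    also have "\<dots> = (V * transpose_mat U) $$ (p, q)"
      using pq by (auto simp: U_def V_def scalar_prod_def lessThan_atLeast0 intro!: sum.cong)
    finally show "(?S * transpose_mat ?S - 1\<^sub>m n * (- 1\<^sub>m n)) $$ (p, q) =
        (V * transpose_mat U) $$ (p, q)" .
  qed (use S in \<open>auto simp: U_def V_def\<close>)
  also have "det (V * transpose_mat U) = det V * det (transpose_mat U)"
    by (rule det_mult[of _ n]) (auto simp: U_def V_def)
  also have "det (transpose_mat U) = det U"
    by (rule det_transpose[of _ n]) (simp add: U_def)
  also have "det U = 1"
    by (subst det_upper_triangular[of _ n])
      (auto simp: U_def prod_list_diag_prod upper_triangular_def schroeder_factor_nth)
  also have "det V = (\<Prod>k<n. 2 ^ (n - k))"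
    by (subst det_upper_triangular[of _ n])
      (auto simp: V_def prod_list_diag_prod upper_triangular_def schroeder_factor_nth lessThan_atLeast0)
  also have "\<dots> = (\<Prod>k<n. 2 ^ Suc k)"
    by (rule prod.reindex_bij_witness[of _ "\<lambda>k. n - 1 - k" "\<lambda>k. n - 1 - k"]) (auto simp: Suc_diff_Suc)
  also have "\<dots> = 2 ^ (n * (n + 1) div 2)"
  proof (induction n)
    case (Suc n)
    have "Suc n * (Suc n + 1) = n * (n + 1) + Suc n * 2" by (simp add: algebra_simps)
    then have "Suc n * (Suc n + 1) div 2 = n * (n + 1) div 2 + Suc n" by simp
    then show ?case using Suc by (simp only: prod.lessThan_Suc power_add)
  qed simp
  finally show ?thesis by simp
qed

theorem corollary5p3:
  fixes n :: nat
  assumes "n \<ge> 1"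
  shows "int (card (domino_tilings (aztec_diamond n))) =
    Determinant.det (four_block_mat (schroeder_mat n) (1\<^sub>m n)
                                    (- 1\<^sub>m n) (transpose_mat (schroeder_mat n)))"
  by (simp only: card_aztec_tilings det_schroeder)

end
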